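(* Let $G$ be a finite abelian group, let $\mathbf{k}$ be a field with $\operatorname{char}\mathbf{k}\nmid|G|$ containing the $|G|$th roots of unity, and let $V$ be a finite-dimensional representation of $G$ over $\mathbf{k}$, with $N=\dim V$ and a basis $x_1,\dots,x_N$ of $V^*$ on which $G$ acts diagonally. Let $d$ be a positive integer. 1. The points of $L(G,V)$ contained in $d\Omega_N$ generate $L(G,V)$ if and only if $\mathbf{k}(V)^G_{\leq d}$ generates $\mathbf{k}(V)^G$ as a field. 2. The points of $L(G,V)$ contained in $d\Omega_N$ generate a full-rank sublattice of $L(G,V)$ if and only if $\mathbf{k}(V)^G$ is a finite field extension of the field generated by $\mathbf{k}(V)^G_{\leq d}$. Furthermore, when these equivalent conditions hold, the degree of the field extension equals the index of the lattice containment, i.e., $$[\mathbf{k}(V)^G:\mathbf{k}(\mathbf{k}(V)^G_{\leq d})]=[L(G,V):\langle L(G,V)\cap d\Omega_N\rangle].$$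
   Context: $\mathbf{k}[V]=\mathbf{k}[x_1,\dots,x_N]$ is the polynomial ring of $V$ (the symmetric algebra of $V^*$, with its induced $G$-action), $\mathbf{k}(V)$ is its fraction field, and $\mathbf{k}(V)^G$ is the field of invariant rational functions. For $f\in\mathbf{k}(V)$ written as $f=f_1/f_2$ with $f_1,f_2\in\mathbf{k}[V]$ and $\gcd(f_1,f_2)=1$, the degree of $f$ is $\deg f:=\deg f_1+\deg f_2$ (constants, including $0$, have degree $0$). $\mathbf{k}(V)^G_{\leq d}$ is the set of invariant rational functions of degree $\leq d$, and $\mathbf{k}(\mathbf{k}(V)^G_{\leq d})$ is the subfield of $\mathbf{k}(V)^G$ it generates over $\mathbf{k}$. For $\mathbf{a}\in\mathbb{Z}^N$, $\mathbf{x}^{\mathbf{a}}$ is the Laurent monomial in $x_1,\dots,x_N$ with exponent vector $\mathbf{a}$, and $$L(G,V):=\{\mathbf{a}\in\mathbb{Z}^N: g\mathbf{x}^{\mathbf{a}}=\mathbf{x}^{\mathbf{a}}\text{ for all }g\in G\},$$ a subgroup of $\mathbb{Z}^N$. $\Omega_N\subset\mathbb{R}^N$ is the standard cross-polytope, the convex hull of the standard basis vectors and their negatives, equivalently the closed unit ball of the $L^1$ norm. $\langle A\rangle$ denotes the subgroup generated by $A$; "full-rank" means having the same rank as $L(G,V)$, namely $N$. *)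

theory Defs
  imports
    "HOL-Algebra.Algebra"
    "HOL-Algebra.Algebraic_Closure_Type"
    "HOL-Library.Function_Algebras"
    "HOL-Library.Poly_Mapping"
    "HOL-Computational_Algebra.Fraction_Field"
begin

section \<open>Representations and their duals\<close>

definition is_linear_rep ::
  "('g, 'm) monoid_scheme \<Rightarrow> ('k::field \<Rightarrow> 'v::ab_group_add \<Rightarrow> 'v) \<Rightarrow> ('g \<Rightarrow> 'v \<Rightarrow> 'v) \<Rightarrow> bool" where
  "is_linear_rep G scale \<rho> \<longleftrightarrow>
     (\<forall>g\<in>carrier G. Vector_Spaces.linear scale scale (\<rho> g)) \<and>
     \<rho> \<one>\<^bsub>G\<^esub> = id \<and>
     (\<forall>g\<in>carrier G. \<forall>h\<in>carrier G. \<rho> (g \<otimes>\<^bsub>G\<^esub> h) = \<rho> g \<circ> \<rho> h)"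

definition dual_space :: "('k::field \<Rightarrow> 'v::ab_group_add \<Rightarrow> 'v) \<Rightarrow> ('v \<Rightarrow> 'k) set" where
  "dual_space scale = {f. Vector_Spaces.linear scale (*) f}"

definition fun_scale :: "'k::field \<Rightarrow> ('v \<Rightarrow> 'k) \<Rightarrow> 'v \<Rightarrow> 'k" where
  "fun_scale c f = (\<lambda>v. c * f v)"

definition dual_act ::
  "('g, 'm) monoid_scheme \<Rightarrow> ('g \<Rightarrow> 'v \<Rightarrow> 'v) \<Rightarrow> 'g \<Rightarrow> ('v \<Rightarrow> 'k) \<Rightarrow> 'v \<Rightarrow> 'k" where
  "dual_act G \<rho> g f = f \<circ> \<rho> (inv\<^bsub>G\<^esub> g)"

text \<open>The basis \<open>x\<^sub>1, \<dots>, x\<^sub>N\<close> is indexed by \<open>i < N\<close>.\<close>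

definition is_dual_basis ::
  "('k::field \<Rightarrow> 'v::ab_group_add \<Rightarrow> 'v) \<Rightarrow> nat \<Rightarrow> (nat \<Rightarrow> 'v \<Rightarrow> 'k) \<Rightarrow> bool" where
  "is_dual_basis scale N x \<longleftrightarrow>
     inj_on x {..<N} \<and>
     \<not> module.dependent fun_scale (x ` {..<N}) \<and>
     module.span fun_scale (x ` {..<N}) = dual_space scale"

definition acts_diagonally ::
  "('g, 'm) monoid_scheme \<Rightarrow> ('g \<Rightarrow> 'v \<Rightarrow> 'v) \<Rightarrow> nat \<Rightarrow> (nat \<Rightarrow> 'v \<Rightarrow> 'k::field) \<Rightarrow> bool" where
  "acts_diagonally G \<rho> N x \<longleftrightarrow>
     (\<forall>g\<in>carrier G. \<forall>i<N. \<exists>c. dual_act G \<rho> g (x i) = fun_scale c (x i))"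


section \<open>Polynomials and rational functions\<close>

text \<open>
  Polynomials in countably many formal variables; an exponent vector is a finitely supported
  function \<open>nat \<Rightarrow>\<^sub>0 nat\<close>. The ring \<open>k[V]\<close> is the subring of those polynomials that only
  involve the variables with index below \<open>N\<close>; the formal variable \<open>pvar i\<close> stands for the
  linear form \<open>x i\<close>.
\<close>

type_synonym 'k mpoly = "(nat \<Rightarrow>\<^sub>0 nat) \<Rightarrow>\<^sub>0 'k"
type_synonym 'k ratfun = "'k mpoly fract"

definition pconst :: "'k::field \<Rightarrow> 'k mpoly" where
  "pconst c = Poly_Mapping.single 0 c"

definition pvar :: "nat \<Rightarrow> 'k::field mpoly" where
  "pvar i = Poly_Mapping.single (Poly_Mapping.single i 1) 1"

definition polys :: "nat \<Rightarrow> 'k::field mpoly set" where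
  "polys N = {p. \<forall>m\<in>Poly_Mapping.keys p. Poly_Mapping.keys m \<subseteq> {..<N}}"

abbreviation kV_ring :: "nat \<Rightarrow> 'k::field mpoly ring" where
  "kV_ring N \<equiv> ring_of_type_algebra\<lparr>carrier := polys N\<rparr>"

definition total_deg :: "'k::field mpoly \<Rightarrow> nat" where
  "total_deg p =
     Max (insert 0 ((\<lambda>m. \<Sum>i\<in>Poly_Mapping.keys m. Poly_Mapping.lookup m i) ` Poly_Mapping.keys p))"

definition ratfuns :: "nat \<Rightarrow> 'k::field ratfun set" where
  "ratfuns N = {Fraction_Field.Fract p q | p q. p \<in> polys N \<and> q \<in> polys N \<and> q \<noteq> 0}"

definition rconsts :: "'k::field ratfun set" where
  "rconsts = range (\<lambda>c. Fraction_Field.Fract (pconst c) 1)"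

definition is_reduced_fraction ::
  "nat \<Rightarrow> 'k::field ratfun \<Rightarrow> 'k mpoly \<Rightarrow> 'k mpoly \<Rightarrow> bool" where
  "is_reduced_fraction N f f1 f2 \<longleftrightarrow>
     f1 \<in> polys N \<and> f2 \<in> polys N \<and> f2 \<noteq> 0 \<and> f = Fraction_Field.Fract f1 f2 \<and>
     1 gcdof\<^bsub>kV_ring N\<^esub> f1 f2"

text \<open>
  Since \<open>k[V]\<close> is a factorial domain, a reduced fraction exists for every element of \<open>k(V)\<close>
  and is unique up to a common nonzero constant, so the choice below does not matter.
\<close>

definition rat_deg :: "nat \<Rightarrow> 'k::field ratfun \<Rightarrow> nat" where
  "rat_deg N f =
     (let (f1, f2) = (SOME (f1, f2). is_reduced_fraction N f f1 f2)
      in total_deg f1 + total_deg f2)"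


section \<open>The induced action\<close>

text \<open>
  The action on \<open>k[V] = Sym(V\<^sup>*)\<close> extends the action on \<open>V\<^sup>*\<close> multiplicatively: \<open>g\<close> substitutes for
  the variable \<open>pvar i\<close> the expansion of the linear form \<open>g \<cdot> x i\<close> in the basis \<open>x\<close>.
  It passes to fractions; the value \<open>h\<close> in \<open>rat_act\<close> does not depend on the chosen representation
  \<open>p / q\<close> because the action on \<open>k[V]\<close> is by ring automorphisms. Outside \<open>k(V)\<close> (the set
  \<open>ratfuns N\<close>) the value of \<open>rat_act\<close> is irrelevant.
\<close>

definition lin_form_act ::
  "('g, 'm) monoid_scheme \<Rightarrow> ('g \<Rightarrow> 'v \<Rightarrow> 'v) \<Rightarrow> nat \<Rightarrow> (nat \<Rightarrow> 'v \<Rightarrow> 'k::field) \<Rightarrow> 'g \<Rightarrow> nat \<Rightarrow> 'k mpoly" where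
  "lin_form_act G \<rho> N x g i =
     (\<Sum>j<N. pconst (module.representation fun_scale (x ` {..<N}) (dual_act G \<rho> g (x i)) (x j)) * pvar j)"

definition poly_act ::
  "('g, 'm) monoid_scheme \<Rightarrow> ('g \<Rightarrow> 'v \<Rightarrow> 'v) \<Rightarrow> nat \<Rightarrow> (nat \<Rightarrow> 'v \<Rightarrow> 'k::field) \<Rightarrow> 'g \<Rightarrow> 'k mpoly \<Rightarrow> 'k mpoly" where
  "poly_act G \<rho> N x g p =
     (\<Sum>m\<in>Poly_Mapping.keys p. pconst (Poly_Mapping.lookup p m) *
        (\<Prod>i<N. lin_form_act G \<rho> N x g i ^ Poly_Mapping.lookup m i))"

definition rat_act ::
  "('g, 'm) monoid_scheme \<Rightarrow> ('g \<Rightarrow> 'v \<Rightarrow> 'v) \<Rightarrow> nat \<Rightarrow> (nat \<Rightarrow> 'v \<Rightarrow> 'k::field) \<Rightarrow> 'g \<Rightarrow> 'k ratfun \<Rightarrow> 'k ratfun" where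
  "rat_act G \<rho> N x g f =
     (THE h. \<exists>p\<in>polys N. \<exists>q\<in>polys N. q \<noteq> 0 \<and> f = Fraction_Field.Fract p q \<and>
             h = Fraction_Field.Fract (poly_act G \<rho> N x g p) (poly_act G \<rho> N x g q))"

definition inv_field ::
  "('g, 'm) monoid_scheme \<Rightarrow> ('g \<Rightarrow> 'v \<Rightarrow> 'v) \<Rightarrow> nat \<Rightarrow> (nat \<Rightarrow> 'v \<Rightarrow> 'k::field) \<Rightarrow> 'k ratfun set" where
  "inv_field G \<rho> N x = {f \<in> ratfuns N. \<forall>g\<in>carrier G. rat_act G \<rho> N x g f = f}"

definition inv_le ::
  "('g, 'm) monoid_scheme \<Rightarrow> ('g \<Rightarrow> 'v \<Rightarrow> 'v) \<Rightarrow> nat \<Rightarrow> (nat \<Rightarrow> 'v \<Rightarrow> 'k::field) \<Rightarrow> nat \<Rightarrow> 'k ratfun set" where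
  "inv_le G \<rho> N x d = {f \<in> inv_field G \<rho> N x. rat_deg N f \<le> d}"

definition gen_subfield :: "'k::field ratfun set \<Rightarrow> 'k ratfun set" where
  "gen_subfield S = generate_field ring_of_type_algebra (rconsts \<union> S)"


section \<open>The lattice of invariant Laurent monomials\<close>

text \<open>The group \<open>\<int>\<^sup>N\<close> is represented by finitely supported functions \<open>nat \<Rightarrow>\<^sub>0 int\<close>.\<close>

abbreviation Z_pow :: "nat \<Rightarrow> (nat \<Rightarrow>\<^sub>0 int) monoid" where
  "Z_pow N \<equiv> free_Abelian_group {..<N}"

definition laurent_monomial :: "nat \<Rightarrow> (nat \<Rightarrow>\<^sub>0 int) \<Rightarrow> 'k::field ratfun" where
  "laurent_monomial N a = (\<Prod>i<N. Fraction_Field.Fract (pvar i) 1 powi Poly_Mapping.lookup a i)"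

definition inv_lattice ::
  "('g, 'm) monoid_scheme \<Rightarrow> ('g \<Rightarrow> 'v \<Rightarrow> 'v) \<Rightarrow> nat \<Rightarrow> (nat \<Rightarrow> 'v \<Rightarrow> 'k::field) \<Rightarrow> (nat \<Rightarrow>\<^sub>0 int) set" where
  "inv_lattice G \<rho> N x =
     {a \<in> carrier (Z_pow N). \<forall>g\<in>carrier G.
        rat_act G \<rho> N x g (laurent_monomial N a) = laurent_monomial N a}"

text \<open>\<open>\<real>\<^sup>N\<close> is represented by the functions \<open>nat \<Rightarrow> real\<close> that vanish from index \<open>N\<close> on.\<close>

definition cross_polytope :: "nat \<Rightarrow> (nat \<Rightarrow> real) set" where
  "cross_polytope N = {v. (\<forall>i\<ge>N. v i = 0) \<and> (\<Sum>i<N. \<bar>v i\<bar>) \<le> 1}"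

definition dilate :: "nat \<Rightarrow> (nat \<Rightarrow> real) set \<Rightarrow> (nat \<Rightarrow> real) set" where
  "dilate d P = (\<lambda>v i. real d * v i) ` P"

definition lattice_points_in :: "(nat \<Rightarrow>\<^sub>0 int) set \<Rightarrow> (nat \<Rightarrow> real) set \<Rightarrow> (nat \<Rightarrow>\<^sub>0 int) set" where
  "lattice_points_in L P = {a \<in> L. (\<lambda>i. real_of_int (Poly_Mapping.lookup a i)) \<in> P}"

text \<open>
  The rank of a subgroup of some \<open>\<int>\<^sup>N\<close>: the maximal number of \<open>\<int>\<close>-linearly independent elements,
  where \<open>frag_cmul\<close> is the scalar multiplication by integers.
\<close>

definition lattice_rank :: "(nat \<Rightarrow>\<^sub>0 int) set \<Rightarrow> nat" where
  "lattice_rank L = Max {card B | B. B \<subseteq> L \<and> finite B \<and> \<not> module.dependent frag_cmul B}"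

definition subgroup_index :: "nat \<Rightarrow> (nat \<Rightarrow>\<^sub>0 int) set \<Rightarrow> (nat \<Rightarrow>\<^sub>0 int) set \<Rightarrow> nat" where
  "subgroup_index N L M = card (rcosets\<^bsub>(Z_pow N)\<lparr>carrier := L\<rparr>\<^esub> M)"

end

theory Submission
  imports Defs
begin

text \<open>The group acts on every variable through a character, so it multiplies each monomial by a scalar,
  its weight. An invariant rational function is a quotient \<open>p / q\<close> of two semi-invariants of equal
  weight whose monomials all occur in any prescribed representation of the function: otherwise
  subtracting \<open>g p\<close> and \<open>g q\<close> from suitable multiples of \<open>p\<close> and \<open>q\<close> would give a shorter
  denominator (\<open>semi_invariant_representation\<close>). All ratios of monomials of \<open>p\<close> and \<open>q\<close> are then
  invariant. Dividing \<open>p\<close> by a monomial of \<open>q\<close>, and \<open>q\<close> by a monomial of \<open>p\<close>, expresses the function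
  through invariant Laurent monomials \<open>x\<^sup>a\<close> with \<open>|a|\<^sub>1\<close> at most its degree
  (\<open>invariant_in_field\<close>). Since the degree of \<open>x\<^sup>a\<close> is in turn at most \<open>|a|\<^sub>1\<close>
  (\<open>rat_deg_laurent_monomial\<close>), the field of invariants is the field \<open>k(L)\<close> generated by all
  invariant monomials, and the invariants of degree at most \<open>d\<close> generate \<open>k(M)\<close>, where \<open>M\<close> is
  generated by the points of \<open>L\<close> in \<open>d \<Omega>\<^sub>N\<close>.

  It remains to compare \<open>k(M)\<close> and \<open>k(L)\<close> for lattices \<open>M \<subseteq> L\<close>. Monomials from different cosets
  of \<open>M\<close> are linearly independent over \<open>k(M)\<close>: after clearing denominators, a relation would involve
  Laurent polynomials with disjoint supports (\<open>independent_coset_monomials\<close>). If there are finitely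
  many cosets, the span of representatives is a finite-dimensional ring, hence a field, and equals
  \<open>k(L)\<close> (\<open>Span_coset_monomials\<close>). So the degree of the extension is the index, and it is
  infinite when the index is. Finally, \<open>L\<close> contains \<open>|G| \<int>\<^sup>N\<close>, so finite index of \<open>M\<close> means that
  \<open>M\<close> contains a positive multiple of every element of \<open>L\<close>, which is to say that the ranks agree
  (\<open>lattice_rank_eq_iff\<close>, \<open>torsion_imp_finite_cosets\<close>).

  Degrees refer to reduced fractions. These exist because a fraction of minimal degree is reduced
  (\<open>reduced_fraction_exists\<close>), and for a Laurent monomial they can be determined by comparing
  exponents.\<close>

section \<open>Total degree and monomial expansion\<close>

definition monom_deg :: "(nat \<Rightarrow>\<^sub>0 nat) \<Rightarrow> nat" where
  "monom_deg m = (\<Sum>i\<in>Poly_Mapping.keys m. Poly_Mapping.lookup m i)"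

lemma monom_deg_eq_sum:
  assumes "finite A" "Poly_Mapping.keys m \<subseteq> A"
  shows "monom_deg m = (\<Sum>i\<in>A. Poly_Mapping.lookup m i)"
  unfolding monom_deg_def
  by (rule sum.mono_neutral_left) (use assms in \<open>auto simp: in_keys_iff\<close>)

lemma monom_deg_add: "monom_deg (m + n) = monom_deg m + monom_deg n"
proof -
  let ?A = "Poly_Mapping.keys m \<union> Poly_Mapping.keys n"
  have "monom_deg (m + n) = (\<Sum>i\<in>?A. Poly_Mapping.lookup (m + n) i)"
    by (rule monom_deg_eq_sum) (use Poly_Mapping.keys_add[of m n] in auto)
  also have "\<dots> = (\<Sum>i\<in>?A. Poly_Mapping.lookup m i) + (\<Sum>i\<in>?A. Poly_Mapping.lookup n i)"
    by (simp add: lookup_add sum.distrib)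
  also have "\<dots> = monom_deg m + monom_deg n"
    by (subst (1 2) monom_deg_eq_sum[of ?A]) auto
  finally show ?thesis .
qed

lemma monom_deg_eq_0_iff: "monom_deg m = 0 \<longleftrightarrow> m = 0"
proof
  assume "monom_deg m = 0"
  then have "\<forall>i\<in>Poly_Mapping.keys m. Poly_Mapping.lookup m i = 0"
    by (simp add: monom_deg_def)
  then have "Poly_Mapping.keys m = {}" by (metis all_not_in_conv in_keys_iff)
  then show "m = 0" by simp
qed (simp add: monom_deg_def)

lemma total_deg_eq_Max: "total_deg p = Max (insert 0 (monom_deg ` Poly_Mapping.keys p))"
  by (simp add: total_deg_def monom_deg_def image_def)

lemma monom_deg_le_total_deg: "m \<in> Poly_Mapping.keys p \<Longrightarrow> monom_deg m \<le> total_deg p"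
  unfolding total_deg_eq_Max by (rule Max_ge) auto

lemma total_deg_attained:
  assumes "p \<noteq> 0"
  obtains m where "m \<in> Poly_Mapping.keys p" "monom_deg m = total_deg p"
proof -
  have ne: "Poly_Mapping.keys p \<noteq> {}" using assms by simp
  have "total_deg p \<in> insert 0 (monom_deg ` Poly_Mapping.keys p)"
    unfolding total_deg_eq_Max by (rule Max_in) auto
  then consider "total_deg p = 0" | "total_deg p \<in> monom_deg ` Poly_Mapping.keys p" by auto
  then show thesis
  proof cases
    case 1
    obtain m where "m \<in> Poly_Mapping.keys p" using ne by blast
    then show ?thesis using monom_deg_le_total_deg[of m p] 1 that by auto
  next
    case 2
    then show ?thesis using that by auto
  qed
qed

lemma total_deg_0 [simp]: "total_deg 0 = 0"
  by (simp add: total_deg_def)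

lemma total_deg_single: "total_deg (Poly_Mapping.single m c) \<le> monom_deg m"
  by (simp add: total_deg_eq_Max)

lemma poly_eq_sum_single:
  fixes p :: "'a \<Rightarrow>\<^sub>0 'b::comm_monoid_add"
  assumes "finite A" "Poly_Mapping.keys p \<subseteq> A"
  shows "p = (\<Sum>m\<in>A. Poly_Mapping.single m (Poly_Mapping.lookup p m))"
proof (rule poly_mapping_eqI)
  fix k
  have "Poly_Mapping.lookup (\<Sum>m\<in>A. Poly_Mapping.single m (Poly_Mapping.lookup p m)) k
      = (\<Sum>m\<in>A. if m = k then Poly_Mapping.lookup p k else 0)"
    unfolding lookup_sum by (rule sum.cong) (auto simp: lookup_single when_def)
  also have "\<dots> = Poly_Mapping.lookup p k"
    using assms by (auto simp: sum.delta in_keys_iff)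
  finally show "Poly_Mapping.lookup p k
    = Poly_Mapping.lookup (\<Sum>m\<in>A. Poly_Mapping.single m (Poly_Mapping.lookup p m)) k" ..
qed

text \<open>The product of the two leading homogeneous components is nonzero, and every other term of
  the product has smaller degree.\<close>

lemma total_deg_mult_ge:
  fixes p q :: "'k::field mpoly"
  assumes "p \<noteq> 0" "q \<noteq> 0"
  shows "total_deg p + total_deg q \<le> total_deg (p * q)"
proof -
  define top :: "'k mpoly \<Rightarrow> 'k mpoly" where
    "top r = (\<Sum>m\<in>{m\<in>Poly_Mapping.keys r. monom_deg m = total_deg r}.
                Poly_Mapping.single m (Poly_Mapping.lookup r m))" for r
  have lookup_top: "Poly_Mapping.lookup (top r) m
      = (if monom_deg m = total_deg r then Poly_Mapping.lookup r m else 0)" for r m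
  proof -
    have "Poly_Mapping.lookup (top r) m
      = (\<Sum>m'\<in>{m\<in>Poly_Mapping.keys r. monom_deg m = total_deg r}.
           if m' = m then Poly_Mapping.lookup r m else 0)"
      unfolding top_def lookup_sum by (rule sum.cong) (auto simp: lookup_single when_def)
    also have "\<dots> = (if monom_deg m = total_deg r then Poly_Mapping.lookup r m else 0)"
      by (auto simp: sum.delta in_keys_iff)
    finally show ?thesis .
  qed
  have top_keys: "monom_deg m = total_deg r" if "m \<in> Poly_Mapping.keys (top r)" for m r
    using that by (auto simp: in_keys_iff lookup_top split: if_splits)
  have rest_keys: "monom_deg m < total_deg r" if m: "m \<in> Poly_Mapping.keys (r - top r)" for m r
  proof -
    have "m \<in> Poly_Mapping.keys r" "monom_deg m \<noteq> total_deg r"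
      using m by (auto simp: in_keys_iff lookup_top lookup_minus split: if_splits)
    then show ?thesis using monom_deg_le_total_deg[of m r] by simp
  qed
  have top_nz: "top r \<noteq> 0" if r: "r \<noteq> 0" for r
  proof -
    obtain m where m: "m \<in> Poly_Mapping.keys r" "monom_deg m = total_deg r"
      using total_deg_attained[OF r] .
    then have "Poly_Mapping.lookup (top r) m \<noteq> 0" by (simp add: lookup_top in_keys_iff)
    then show ?thesis by auto
  qed
  have "top p * top q \<noteq> 0" using top_nz assms by simp
  then have "Poly_Mapping.keys (top p * top q) \<noteq> {}" by simp
  then obtain m where m: "m \<in> Poly_Mapping.keys (top p * top q)" by blast
  then obtain a b where "m = a + b" "a \<in> Poly_Mapping.keys (top p)" "b \<in> Poly_Mapping.keys (top q)"
    using subsetD[OF keys_mult m] by blast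
  then have dm: "monom_deg m = total_deg p + total_deg q"
    using top_keys by (simp add: monom_deg_add)
  define rest where "rest = top p * (q - top q) + (p - top p) * q"
  have eq: "p * q = top p * top q + rest"
    unfolding rest_def by (simp add: algebra_simps)
  have "Poly_Mapping.lookup rest m = 0"
  proof (rule ccontr)
    assume "Poly_Mapping.lookup rest m \<noteq> 0"
    then have "m \<in> Poly_Mapping.keys rest" by (simp add: in_keys_iff)
    then have "m \<in> Poly_Mapping.keys (top p * (q - top q)) \<union> Poly_Mapping.keys ((p - top p) * q)"
      unfolding rest_def by (rule subsetD[OF Poly_Mapping.keys_add])
    then consider (1) "m \<in> Poly_Mapping.keys (top p * (q - top q))"
      | (2) "m \<in> Poly_Mapping.keys ((p - top p) * q)"
      by blast
    then have "monom_deg m < total_deg p + total_deg q"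
    proof cases
      case 1
      then obtain a b where "m = a + b" "a \<in> Poly_Mapping.keys (top p)"
        "b \<in> Poly_Mapping.keys (q - top q)"
        using subsetD[OF keys_mult 1] by blast
      then show ?thesis using top_keys[of a p] rest_keys[of b q] by (simp add: monom_deg_add)
    next
      case 2
      then obtain a b where "m = a + b" "a \<in> Poly_Mapping.keys (p - top p)"
        "b \<in> Poly_Mapping.keys q"
        using subsetD[OF keys_mult 2] by blast
      then show ?thesis
        using rest_keys[of a p] monom_deg_le_total_deg[of b q] by (simp add: monom_deg_add)
    qed
    then show False using dm by simp
  qed
  then have "m \<in> Poly_Mapping.keys (p * q)"
    using m by (simp add: eq in_keys_iff lookup_add)
  then show ?thesis using monom_deg_le_total_deg[of m "p * q"] dm by simp
qed

lemma pconst_simps [simp]: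
  "pconst 0 = 0" "pconst 1 = 1" "pconst (a + b) = pconst a + pconst b"
  "pconst (a * b) = pconst a * pconst b"
  by (simp_all add: pconst_def single_add mult_single)

lemma lookup_pconst_mult [simp]:
  "Poly_Mapping.lookup (pconst c * p) m = c * Poly_Mapping.lookup p m"
  unfolding pconst_def mult_map_scale_conv_mult[symmetric] by (simp add: map.rep_eq when_def)

lemma pconst_eq_0_iff [simp]: "pconst c = 0 \<longleftrightarrow> c = 0"
proof
  assume "pconst c = 0"
  then have "Poly_Mapping.lookup (pconst c) 0 = 0" by simp
  then show "c = 0" by (simp add: pconst_def)
qed simp

lemma total_deg_0_imp_pconst:
  assumes "total_deg p = 0"
  obtains c where "p = pconst c"
proof
  have "Poly_Mapping.keys p \<subseteq> {0}"
    using monom_deg_le_total_deg[of _ p] assms by (auto simp: monom_deg_eq_0_iff)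
  then show "p = pconst (Poly_Mapping.lookup p 0)"
    using poly_eq_sum_single[of "{0}" p] by (simp add: pconst_def)
qed

subsection \<open>The polynomial ring in the first variables\<close>

lemma polys_add: "p \<in> polys N \<Longrightarrow> q \<in> polys N \<Longrightarrow> p + q \<in> polys N"
  using Poly_Mapping.keys_add[of p q] by (force simp: polys_def)

lemma polys_mult: "p \<in> polys N \<Longrightarrow> q \<in> polys N \<Longrightarrow> p * q \<in> polys N"
proof -
  assume pq: "p \<in> polys N" "q \<in> polys N"
  show "p * q \<in> polys N"
    unfolding polys_def
  proof (clarify)
    fix m i assume m: "m \<in> Poly_Mapping.keys (p * q)" and i: "i \<in> Poly_Mapping.keys m"
    obtain a b where "m = a + b" "a \<in> Poly_Mapping.keys p" "b \<in> Poly_Mapping.keys q"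
      using keys_mult[of p q] m by auto
    then show "i < N"
      using pq i Poly_Mapping.keys_add[of a b] by (force simp: polys_def)
  qed
qed

lemma polys_uminus: "p \<in> polys N \<Longrightarrow> - p \<in> polys N"
  by (simp add: polys_def)

lemma polys_single: "Poly_Mapping.keys m \<subseteq> {..<N} \<Longrightarrow> Poly_Mapping.single m c \<in> polys N"
  by (auto simp: polys_def)

lemma polys_pconst [simp]: "pconst c \<in> polys N"
  by (auto simp: polys_def pconst_def)

lemma polys_0 [simp]: "0 \<in> polys N" and polys_1 [simp]: "1 \<in> polys N"
  using polys_pconst[of 0] polys_pconst[of 1] by simp_all

lemma polys_keys: "p \<in> polys N \<Longrightarrow> m \<in> Poly_Mapping.keys p \<Longrightarrow> Poly_Mapping.keys m \<subseteq> {..<N}"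
  by (auto simp: polys_def)

lemma polys_subset:
  "p \<in> polys N \<Longrightarrow> Poly_Mapping.keys q \<subseteq> Poly_Mapping.keys p \<Longrightarrow> q \<in> polys N"
  by (auto simp: polys_def)

lemma kV_ring_simps [simp]:
  "carrier (kV_ring N) = polys N" "monoid.mult (kV_ring N) = (*)"
  "monoid.one (kV_ring N) = 1" "ring.add (kV_ring N) = (+)" "ring.zero (kV_ring N) = 0"
  by (simp_all add: ring_of_type_algebra_def)

text \<open>A representation of minimal total degree is reduced: cancelling a common divisor of positive
  degree would lower the degree, and a common divisor of degree zero is a unit.\<close>

lemma reduced_fraction_exists:
  assumes "f \<in> ratfuns N"
  obtains p q where "is_reduced_fraction N f p q"
proof -
  define P where "P k \<longleftrightarrow> (\<exists>p q. p \<in> polys N \<and> q \<in> polys N \<and> q \<noteq> 0 \<and>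
    f = Fraction_Field.Fract p q \<and> total_deg p + total_deg q = k)" for k
  have "\<exists>k. P k" using assms by (auto simp: P_def ratfuns_def)
  then have "P (LEAST k. P k)" by (meson LeastI_ex)
  then obtain p q where pq: "p \<in> polys N" "q \<in> polys N" "q \<noteq> 0" "f = Fraction_Field.Fract p q"
    and deg: "total_deg p + total_deg q = (LEAST k. P k)" unfolding P_def by blast
  have "h divides\<^bsub>kV_ring N\<^esub> 1"
    if h: "h divides\<^bsub>kV_ring N\<^esub> p" "h divides\<^bsub>kV_ring N\<^esub> q" "h \<in> polys N" for h
  proof -
    obtain p' q' where p': "p' \<in> polys N" "p = h * p'" and q': "q' \<in> polys N" "q = h * q'"
      using h by (auto simp: factor_def)
    have nz: "h \<noteq> 0" "q' \<noteq> 0" using pq q' by auto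
    have "f = Fraction_Field.Fract p' q'"
      using pq p' q' nz by (simp add: mult_fract_cancel)
    then have "P (total_deg p' + total_deg q')"
      using p' q' nz unfolding P_def by blast
    then have "total_deg p + total_deg q \<le> total_deg p' + total_deg q'"
      unfolding deg by (rule Least_le)
    moreover have "total_deg h + total_deg q' \<le> total_deg q"
      using total_deg_mult_ge[of h q'] nz q' by simp
    moreover have "total_deg p' \<le> total_deg p"
      using total_deg_mult_ge[of h p'] nz p' by (cases "p' = 0") auto
    ultimately have "total_deg h = 0" by simp
    then obtain c where c: "h = pconst c" using total_deg_0_imp_pconst by blast
    then have "c \<noteq> 0" using nz by auto
    then have "1 = h * pconst (inverse c)"
      unfolding c by (simp flip: pconst_simps(4))
    then show ?thesis unfolding factor_def by auto
  qed
  moreover have "1 divides\<^bsub>kV_ring N\<^esub> p" "1 divides\<^bsub>kV_ring N\<^esub> q"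
    using pq by (auto simp: factor_def)
  ultimately have "is_reduced_fraction N f p q"
    using pq by (auto simp: is_reduced_fraction_def isgcd_def)
  then show thesis by (rule that)
qed

lemma rat_deg_witness:
  assumes "f \<in> ratfuns N"
  obtains p q where "is_reduced_fraction N f p q" "rat_deg N f = total_deg p + total_deg q"
proof -
  define pq where "pq = (SOME (f1, f2). is_reduced_fraction N f f1 f2)"
  obtain p0 q0 where pq0: "is_reduced_fraction N f p0 q0" using reduced_fraction_exists[OF assms] .
  have "case pq of (f1, f2) \<Rightarrow> is_reduced_fraction N f f1 f2"
    unfolding pq_def by (rule someI[of _ "(p0, q0)"]) (use pq0 in simp)
  moreover have "rat_deg N f = (case pq of (f1, f2) \<Rightarrow> total_deg f1 + total_deg f2)"
    by (simp add: rat_deg_def pq_def)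
  ultimately show thesis using that by (cases pq) auto
qed

section \<open>Laurent monomials\<close>

definition rconst :: "'k::field \<Rightarrow> 'k ratfun" where
  "rconst c = to_fract (pconst c)"

lemma rconst_simps [simp]:
  "rconst 0 = 0" "rconst 1 = 1" "rconst (a + b) = rconst a + rconst b"
  "rconst (a * b) = rconst a * rconst b" "rconst c = 0 \<longleftrightarrow> c = 0"
  by (simp_all add: rconst_def)

lemma rconst_uminus: "rconst (- c) = - rconst c"
proof -
  have "rconst c + rconst (- c) = rconst (c + - c)" by (simp only: rconst_simps(3))
  then show ?thesis by (simp add: add_eq_0_iff del: rconst_simps(3))
qed

lemma rconsts_eq: "rconsts = range rconst"
  by (simp add: rconsts_def rconst_def to_fract_def)

lemma to_fract_sum: "to_fract (sum f A) = (\<Sum>a\<in>A. to_fract (f a))"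
  by (induction A rule: infinite_finite_induct) auto

lemma to_fract_prod: "to_fract (prod f A) = (\<Prod>a\<in>A. to_fract (f a))"
  by (induction A rule: infinite_finite_induct) auto

lemma to_fract_power: "to_fract (p ^ n) = to_fract p ^ n"
  by (induction n) auto

lemma single_one_nz [simp]: "Poly_Mapping.single m (1::'k::field) \<noteq> 0"
  by (metis lookup_single_eq lookup_zero zero_neq_one)

lemma pvar_nz [simp]: "(pvar i :: 'k::field mpoly) \<noteq> 0"
  by (simp add: pvar_def)

lemma laurent_monomial_eq:
  "laurent_monomial N a = (\<Prod>i<N. to_fract (pvar i) powi Poly_Mapping.lookup a i)"
  by (simp add: laurent_monomial_def to_fract_def)

lemma laurent_monomial_nz [simp]: "laurent_monomial N a \<noteq> 0"
  by (simp add: laurent_monomial_eq)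

lemma laurent_monomial_0 [simp]: "laurent_monomial N 0 = 1"
  by (simp add: laurent_monomial_eq)

lemma laurent_monomial_add:
  "laurent_monomial N (a + b) = laurent_monomial N a * laurent_monomial N b"
  by (simp add: laurent_monomial_eq lookup_add power_int_add prod.distrib)

lemma laurent_monomial_uminus:
  "laurent_monomial N (- a) = inverse (laurent_monomial N a)"
  by (simp add: laurent_monomial_eq power_int_minus flip: prod_inversef)

lemma laurent_monomial_diff:
  "laurent_monomial N (a - b) = laurent_monomial N a / laurent_monomial N b"
  using laurent_monomial_add[of N a "- b"] by (simp add: laurent_monomial_uminus divide_inverse)

text \<open>Exponent vectors of monomials as Laurent exponents, and the positive part of a Laurent exponent;
  \<open>nat_exp a\<close> and \<open>nat_exp (- a)\<close> are the exponents of the numerator and the denominator of \<open>x\<^sup>a\<close>.\<close>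

definition int_exp :: "(nat \<Rightarrow>\<^sub>0 nat) \<Rightarrow> nat \<Rightarrow>\<^sub>0 int" where
  "int_exp m = Poly_Mapping.map int m"

definition nat_exp :: "(nat \<Rightarrow>\<^sub>0 int) \<Rightarrow> nat \<Rightarrow>\<^sub>0 nat" where
  "nat_exp a = Poly_Mapping.map nat a"

lemma lookup_int_exp [simp]: "Poly_Mapping.lookup (int_exp m) i = int (Poly_Mapping.lookup m i)"
  by (simp add: int_exp_def map.rep_eq when_def)

lemma lookup_nat_exp [simp]: "Poly_Mapping.lookup (nat_exp a) i = nat (Poly_Mapping.lookup a i)"
  by (simp add: nat_exp_def map.rep_eq when_def)

lemma int_exp_add: "int_exp (m + n) = int_exp m + int_exp n"
  by (rule poly_mapping_eqI) (simp add: lookup_add)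

lemma keys_int_exp [simp]: "Poly_Mapping.keys (int_exp m) = Poly_Mapping.keys m"
  by (auto simp: in_keys_iff)

lemma keys_nat_exp: "Poly_Mapping.keys (nat_exp a) \<subseteq> Poly_Mapping.keys a"
  by (auto simp: in_keys_iff)

lemma exponent_parts: "int_exp (nat_exp a) - int_exp (nat_exp (- a)) = a"
  by (rule poly_mapping_eqI) (simp add: lookup_minus)

lemma single_pvar_power: "pvar i ^ n = Poly_Mapping.single (Poly_Mapping.single i n) 1"
proof (induction n)
  case (Suc n)
  show ?case
    unfolding power_Suc Suc.IH by (simp add: pvar_def mult_single flip: single_add)
qed simp

lemma prod_single_one:
  "(\<Prod>i\<in>A. Poly_Mapping.single (f i) (1::'b::comm_semiring_1)) = Poly_Mapping.single (\<Sum>i\<in>A. f i) 1"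
  by (induction A rule: infinite_finite_induct) (auto simp: mult_single)

lemma prod_pvar_power:
  assumes "Poly_Mapping.keys m \<subseteq> {..<N}"
  shows "(\<Prod>i<N. pvar i ^ Poly_Mapping.lookup m i) = Poly_Mapping.single m 1"
  unfolding single_pvar_power prod_single_one using poly_eq_sum_single[of "{..<N}" m] assms
  by simp

lemma to_fract_single:
  assumes "Poly_Mapping.keys m \<subseteq> {..<N}"
  shows "to_fract (Poly_Mapping.single m c) = rconst c * laurent_monomial N (int_exp m)"
proof -
  have "Poly_Mapping.single m c = pconst c * (\<Prod>i<N. pvar i ^ Poly_Mapping.lookup m i)"
    by (simp add: prod_pvar_power[OF assms] pconst_def mult_single)
  then show ?thesis
    by (simp add: to_fract_prod to_fract_power laurent_monomial_eq rconst_def)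
qed

lemma to_fract_poly:
  assumes "p \<in> polys N"
  shows "to_fract p = (\<Sum>m\<in>Poly_Mapping.keys p.
           rconst (Poly_Mapping.lookup p m) * laurent_monomial N (int_exp m))"
proof -
  have "to_fract p
    = (\<Sum>m\<in>Poly_Mapping.keys p. to_fract (Poly_Mapping.single m (Poly_Mapping.lookup p m)))"
    unfolding to_fract_sum[symmetric] by (rule arg_cong[where f = to_fract]) (rule poly_eq_sum_single, auto)
  also have "\<dots> = (\<Sum>m\<in>Poly_Mapping.keys p.
           rconst (Poly_Mapping.lookup p m) * laurent_monomial N (int_exp m))"
    by (rule sum.cong[OF refl], rule to_fract_single, rule polys_keys[OF assms])
  finally show ?thesis .
qed

lemma laurent_monomial_as_Fract:
  assumes "Poly_Mapping.keys a \<subseteq> {..<N}"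
  shows "laurent_monomial N a
    = Fraction_Field.Fract (Poly_Mapping.single (nat_exp a) 1) (Poly_Mapping.single (nat_exp (- a)) 1)"
proof -
  have k: "Poly_Mapping.keys (nat_exp a) \<subseteq> {..<N}" "Poly_Mapping.keys (nat_exp (- a)) \<subseteq> {..<N}"
    using assms keys_nat_exp[of a] keys_nat_exp[of "- a"] by auto
  have "laurent_monomial N a
     = laurent_monomial N (int_exp (nat_exp a)) / laurent_monomial N (int_exp (nat_exp (- a)))"
    by (simp add: exponent_parts flip: laurent_monomial_diff)
  then show ?thesis
    using k by (simp add: Fract_conv_to_fract to_fract_single)
qed

lemma laurent_monomial_in_ratfuns:
  assumes "Poly_Mapping.keys a \<subseteq> {..<N}"
  shows "laurent_monomial N a \<in> ratfuns N"
proof -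
  have "Poly_Mapping.single (nat_exp a) 1 \<in> polys N" "Poly_Mapping.single (nat_exp (- a)) 1 \<in> polys N"
    using assms keys_nat_exp[of a] keys_nat_exp[of "- a"] by (auto intro!: polys_single)
  then show ?thesis
    unfolding laurent_monomial_as_Fract[OF assms] ratfuns_def by (auto intro!: exI)
qed

text \<open>Multiplying by a monomial of large exponents turns a Laurent relation into a polynomial
  one, whose coefficients can be compared.\<close>

lemma laurent_sum_eq_0:
  assumes "finite A" "\<And>a. a \<in> A \<Longrightarrow> Poly_Mapping.keys a \<subseteq> {..<N}"
    and sum0: "(\<Sum>a\<in>A. rconst (c a) * laurent_monomial N a) = 0"
    and a: "a \<in> A"
  shows "c a = 0"
proof -
  define s :: "nat \<Rightarrow>\<^sub>0 int" where "s = (\<Sum>b\<in>A. Poly_Mapping.map abs b)"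
  have lookup_s: "Poly_Mapping.lookup s i = (\<Sum>b\<in>A. \<bar>Poly_Mapping.lookup b i\<bar>)" for i
    unfolding s_def lookup_sum by (rule sum.cong) (auto simp: map.rep_eq when_def)
  have nonneg: "0 \<le> Poly_Mapping.lookup (b + s) i" if "b \<in> A" for b i
  proof -
    have "\<bar>Poly_Mapping.lookup b i\<bar> \<le> Poly_Mapping.lookup s i"
      unfolding lookup_s by (rule member_le_sum) (use that assms in auto)
    then show ?thesis by (simp add: lookup_add)
  qed
  have int_nat: "int_exp (nat_exp (b + s)) = b + s" if "b \<in> A" for b
    by (rule poly_mapping_eqI) (use nonneg[OF that] in simp)
  have keys: "Poly_Mapping.keys (nat_exp (b + s)) \<subseteq> {..<N}" if "b \<in> A" for b
  proof -
    have lookup_0: "Poly_Mapping.lookup e i = 0" if "e \<in> A" "i \<notin> {..<N}" for e i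
      using subsetD[OF assms(2)[OF that(1)], of i] that(2) in_keys_iff[of i e] by argo
    show ?thesis
    proof (rule subsetI, rule ccontr)
      fix i assume i: "i \<in> Poly_Mapping.keys (nat_exp (b + s))" "i \<notin> {..<N}"
      have "Poly_Mapping.lookup (b + s) i = 0"
        unfolding lookup_add lookup_s using lookup_0[OF _ i(2)] \<open>b \<in> A\<close> by simp
      then show False using i(1) by (simp add: in_keys_iff)
    qed
  qed
  have "to_fract (\<Sum>b\<in>A. Poly_Mapping.single (nat_exp (b + s)) (c b))
      = (\<Sum>b\<in>A. rconst (c b) * laurent_monomial N b) * laurent_monomial N s"
    unfolding to_fract_sum sum_distrib_right
  proof (rule sum.cong)
    fix b assume b: "b \<in> A"
    show "to_fract (Poly_Mapping.single (nat_exp (b + s)) (c b))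
      = rconst (c b) * laurent_monomial N b * laurent_monomial N s"
      by (simp only: to_fract_single[OF keys[OF b]] int_nat[OF b] laurent_monomial_add mult.assoc)
  qed simp
  then have "(\<Sum>b\<in>A. Poly_Mapping.single (nat_exp (b + s)) (c b)) = 0"
    by (simp only: sum0 mult_zero_left to_fract_eq_0_iff)
  then have "Poly_Mapping.lookup (\<Sum>b\<in>A. Poly_Mapping.single (nat_exp (b + s)) (c b)) (nat_exp (a + s))
      = Poly_Mapping.lookup 0 (nat_exp (a + s))"
    by (rule arg_cong)
  then have "(\<Sum>b\<in>A. Poly_Mapping.lookup (Poly_Mapping.single (nat_exp (b + s)) (c b)) (nat_exp (a + s))) = 0"
    unfolding lookup_sum lookup_zero .
  moreover have "(\<Sum>b\<in>A. Poly_Mapping.lookup (Poly_Mapping.single (nat_exp (b + s)) (c b)) (nat_exp (a + s)))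
      = (\<Sum>b\<in>A. if b = a then c a else 0)"
  proof (rule sum.cong)
    fix b assume b: "b \<in> A"
    have "b = a" if "nat_exp (b + s) = nat_exp (a + s)"
      using arg_cong[OF that, of int_exp] unfolding int_nat[OF b] int_nat[OF a] by simp
    then show "Poly_Mapping.lookup (Poly_Mapping.single (nat_exp (b + s)) (c b)) (nat_exp (a + s))
        = (if b = a then c a else 0)"
      by (auto simp: lookup_single when_def)
  qed simp
  ultimately show ?thesis using assms(1) a by (simp add: sum.delta)
qed

lemma laurent_monomial_inj:
  assumes "Poly_Mapping.keys a \<subseteq> {..<N}" "Poly_Mapping.keys b \<subseteq> {..<N}"
    and "laurent_monomial N a = (laurent_monomial N b :: 'k::field ratfun)"
  shows "a = b"
proof (rule ccontr)
  assume ne: "a \<noteq> b"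
  define c :: "(nat \<Rightarrow>\<^sub>0 int) \<Rightarrow> 'k" where "c e = (if e = a then 1 else - 1)" for e
  have "c a = 0"
    by (rule laurent_sum_eq_0[of "{a, b}" N c])
      (use assms ne in \<open>auto simp: c_def rconst_uminus\<close>)
  then show False by (simp add: c_def)
qed

subsection \<open>Monomials as a basis over the constants\<close>

interpretation kspace: vector_space "\<lambda>c f. rconst c * (f :: 'k::field ratfun)"
  by unfold_locales (auto simp: algebra_simps)

lemma laurent_monomials_independent:
  "kspace.independent (laurent_monomial N ` {a. Poly_Mapping.keys a \<subseteq> {..<N}})"
  unfolding kspace.independent_explicit_module
proof (intro allI impI)
  fix t :: "'a ratfun set" and u v
  assume t: "finite t" "t \<subseteq> laurent_monomial N ` {a. Poly_Mapping.keys a \<subseteq> {..<N}}"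
    and sum0: "(\<Sum>v\<in>t. rconst (u v) * v) = 0" and v: "v \<in> t"
  obtain A where A: "A \<subseteq> {a. Poly_Mapping.keys a \<subseteq> {..<N}}"
    "inj_on (laurent_monomial N :: _ \<Rightarrow> 'a ratfun) A" "t = laurent_monomial N ` A"
    using t(2) unfolding subset_image_inj by blast
  have "finite A" using A t by (simp add: finite_image_iff)
  moreover have "(\<Sum>a\<in>A. rconst (u (laurent_monomial N a)) * laurent_monomial N a) = 0"
    using sum0 A by (simp add: sum.reindex)
  moreover obtain a where "a \<in> A" "v = laurent_monomial N a" using v A by blast
  ultimately show "u v = 0"
    using laurent_sum_eq_0[of A N "\<lambda>a. u (laurent_monomial N a)" a] A(1) by blast
qed

lemma (in vector_space) span_disjoint_Int:
  assumes "independent B" "A1 \<subseteq> B" "A2 \<subseteq> B" "A1 \<inter> A2 = {}" "v \<in> span A1" "v \<in> span A2"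
  shows "v = 0"
proof -
  have "representation B v = representation A1 v" "representation B v = representation A2 v"
    using assms by (auto intro: representation_extend)
  then have "representation B v = (\<lambda>b. 0)"
    using representation_ne_zero[of A1 v] representation_ne_zero[of A2 v] assms(4)
    by (metis disjoint_iff)
  moreover have "v \<in> span B" using assms span_mono by blast
  ultimately show "v = 0"
    using sum_nonzero_representation_eq[OF assms(1)] by fastforce
qed

section \<open>Subfields of a field type and finite-dimensional subrings\<close>

abbreviation type_ring :: "'a::field ring" where
  "type_ring \<equiv> ring_of_type_algebra"

lemma type_ring_field: "Ring.field (type_ring :: 'a::field ring)"
  by (rule field_from_type_algebra)

interpretation R: Ring.cring "type_ring :: 'a::field ring"
  by (rule cring_from_type_algebra)

lemma type_ring_simps [simp]:
  "carrier type_ring = UNIV" "monoid.mult type_ring = (*)" "monoid.one type_ring = 1"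
  "ring.add type_ring = (+)" "ring.zero type_ring = 0"
  by (simp_all add: ring_of_type_algebra_def)

lemma type_ring_a_inv [simp]: "\<ominus>\<^bsub>type_ring\<^esub> x = - x"
  by (rule R.minus_equality) auto

lemma type_ring_m_inv [simp]: "x \<noteq> 0 \<Longrightarrow> inv\<^bsub>type_ring\<^esub> x = inverse x"
  by (rule R.inv_char) auto

lemma type_subfieldI:
  fixes F :: "'a::field set"
  assumes "1 \<in> F" "\<And>a b. a \<in> F \<Longrightarrow> b \<in> F \<Longrightarrow> a + b \<in> F" "\<And>a b. a \<in> F \<Longrightarrow> b \<in> F \<Longrightarrow> a * b \<in> F"
    "\<And>a. a \<in> F \<Longrightarrow> - a \<in> F" "\<And>a. a \<in> F \<Longrightarrow> a \<noteq> 0 \<Longrightarrow> inverse a \<in> F"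
  shows "subfield F type_ring"
  by (rule field.subfieldI'[OF type_ring_field], rule R.subringI) (use assms in auto)

context
  fixes F :: "'a::field set"
  assumes F: "subfield F type_ring"
begin

lemma type_subfield_simps:
  "1 \<in> F" "0 \<in> F" "a \<in> F \<Longrightarrow> b \<in> F \<Longrightarrow> a + b \<in> F" "a \<in> F \<Longrightarrow> b \<in> F \<Longrightarrow> a * b \<in> F"
  "a \<in> F \<Longrightarrow> - a \<in> F"
  using subringE[OF subfieldE(1)[OF F]] by simp_all

lemma type_subfield_inverse: "a \<in> F \<Longrightarrow> inverse a \<in> F"
  using R.subfield_m_inv(1)[OF F, of a] type_subfield_simps(2) by (cases "a = 0") auto

lemma type_subfield_divide: "a \<in> F \<Longrightarrow> b \<in> F \<Longrightarrow> a / b \<in> F"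
  by (simp add: divide_inverse type_subfield_simps type_subfield_inverse)

lemma type_subfield_sum: "(\<And>i. i \<in> I \<Longrightarrow> f i \<in> F) \<Longrightarrow> sum f I \<in> F"
  by (induction I rule: infinite_finite_induct) (auto intro: type_subfield_simps)

end

lemma Span_Cons_iff:
  "v \<in> R.Span K (u # us) \<longleftrightarrow> (\<exists>k\<in>K. \<exists>w\<in>R.Span K us. v = k * u + w)"
  using R.line_extension_mem_iff[of v K u "R.Span K us"] by simp

(* Spans are taken apart one vector at a time, by the equivalence above; the defining fold would
   otherwise be unfolded into line extensions. *)
declare R.Span.simps [simp del]

lemma Span_Nil [simp]: "R.Span K [] = {0}"
  by (simp add: R.Span.simps)

lemma Span_mult_left:
  fixes w :: "'a::field"
  shows "R.Span K (map ((*) w) us) = (*) w ` R.Span K us"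
proof (induction us)
  case (Cons u us)
  show ?case
  proof (intro equalityI subsetI)
    fix v assume "v \<in> R.Span K (map ((*) w) (u # us))"
    then obtain k v' where k: "k \<in> K" "v' \<in> R.Span K us" "v = w * (k * u + v')"
      using Cons by (auto simp: Span_Cons_iff algebra_simps)
    then have "k * u + v' \<in> R.Span K (u # us)" unfolding Span_Cons_iff by blast
    then show "v \<in> (*) w ` R.Span K (u # us)" unfolding k(3) by (rule imageI)
  next
    fix v assume "v \<in> (*) w ` R.Span K (u # us)"
    then obtain k v' where k: "k \<in> K" "v' \<in> R.Span K us" "v = w * (k * u + v')"
      by (auto simp: Span_Cons_iff)
    then have "w * v' \<in> R.Span K (map ((*) w) us)" using Cons by auto
    then show "v \<in> R.Span K (map ((*) w) (u # us))"
      unfolding list.map Span_Cons_iff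
      using k(1,3) by (intro bexI[of _ k] bexI[of _ "w * v'"]) (simp_all add: algebra_simps)
  qed
qed simp

lemma independent_mult_left:
  fixes w :: "'a::field"
  assumes "w \<noteq> 0" "R.independent K us"
  shows "R.independent K (map ((*) w) us)"
  using assms(2)
proof (induction us rule: R.independent.induct)
  case (li_Cons u K us)
  have "w * u \<notin> R.Span K (map ((*) w) us)"
    unfolding Span_mult_left using li_Cons(2) assms(1) by auto
  then show ?case using li_Cons by (simp add: R.independent.li_Cons)
qed simp

text \<open>Multiplication by a nonzero element is injective on a finite-dimensional space, hence maps it
  onto itself, and so it attains the value one.\<close>

lemma finite_dimensional_subring_is_subfield:
  fixes K W :: "'a::field set"
  assumes K: "subfield K type_ring" and dim: "R.dimension n K W"
    and one: "1 \<in> W" and mult: "\<And>a b. a \<in> W \<Longrightarrow> b \<in> W \<Longrightarrow> a * b \<in> W"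
  shows "subfield W type_ring"
proof (rule type_subfieldI)
  note sub = R.space_subgroup_props[OF K dim]
  show "a + b \<in> W" if "a \<in> W" "b \<in> W" for a b using sub(3) that by simp
  show "- a \<in> W" if "a \<in> W" for a using sub(4)[OF that] by simp
  fix w assume w: "w \<in> W" "w \<noteq> 0"
  obtain vs where vs: "R.independent K vs" "length vs = n" "R.Span K vs = W"
    using R.exists_base[OF K dim] by auto
  have "R.independent K (map ((*) w) vs)" using vs(1) w(2) by (simp add: independent_mult_left)
  moreover have "set (map ((*) w) vs) \<subseteq> W"
    using R.Span_base_incl[OF K, of vs] vs(3) w mult by auto
  ultimately have "R.Span K (map ((*) w) vs) = W"
    using R.independent_length_eq_dimension[OF K dim, of "map ((*) w) vs"] vs(2) by simp
  then obtain v where "v \<in> W" "1 = w * v" using one vs(3) unfolding Span_mult_left by (metis imageE)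
  then show "inverse w \<in> W" using w by (metis inverse_unique)
qed (use one mult in auto)


section \<open>Fields generated by Laurent monomials\<close>

lemma gen_subfield_is_subfield: "subfield (gen_subfield S) type_ring"
  unfolding gen_subfield_def by (rule field.generate_field_is_subfield[OF type_ring_field]) simp

lemma rconst_in_gen_subfield: "rconst c \<in> gen_subfield S"
  unfolding gen_subfield_def rconsts_eq by (rule generate_field.incl) simp

lemma subset_gen_subfield: "S \<subseteq> gen_subfield S"
  unfolding gen_subfield_def by (auto intro: generate_field.incl)

lemma gen_subfield_least:
  assumes "subfield F type_ring" "rconsts \<subseteq> F" "S \<subseteq> F"
  shows "gen_subfield S \<subseteq> F"
  unfolding gen_subfield_def using assms by (intro field.generate_field_min_subfield1[OF type_ring_field]) auto

definition monomial_field :: "nat \<Rightarrow> (nat \<Rightarrow>\<^sub>0 int) set \<Rightarrow> 'k::field ratfun set" where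
  "monomial_field N S = gen_subfield (laurent_monomial N ` S)"

definition laurent_polys :: "nat \<Rightarrow> (nat \<Rightarrow>\<^sub>0 int) set \<Rightarrow> 'k::field ratfun set" where
  "laurent_polys N S = kspace.span (laurent_monomial N ` S)"

lemma laurent_polys_monomial: "a \<in> S \<Longrightarrow> laurent_monomial N a \<in> laurent_polys N S"
  unfolding laurent_polys_def by (rule kspace.span_base) simp

lemma laurent_polys_scale: "p \<in> laurent_polys N S \<Longrightarrow> rconst c * p \<in> laurent_polys N S"
  unfolding laurent_polys_def by (rule kspace.span_scale)

lemma laurent_polys_add:
  "p \<in> laurent_polys N S \<Longrightarrow> q \<in> laurent_polys N S \<Longrightarrow> p + q \<in> laurent_polys N S"
  unfolding laurent_polys_def by (rule kspace.span_add)

lemma laurent_polys_0: "0 \<in> laurent_polys N S"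
  unfolding laurent_polys_def by (rule kspace.span_zero)

lemma laurent_polys_mult:
  assumes "p \<in> laurent_polys N S" "q \<in> laurent_polys N T"
    and sum: "\<And>a b. a \<in> S \<Longrightarrow> b \<in> T \<Longrightarrow> a + b \<in> U"
  shows "p * q \<in> laurent_polys N U"
proof -
  have *: "laurent_monomial N a * q \<in> laurent_polys N U" if a: "a \<in> S" for a
    using assms(2) unfolding laurent_polys_def[of N T]
  proof (induction rule: kspace.span_induct_alt)
    case base
    then show ?case by (simp add: laurent_polys_0)
  next
    case (step c x y)
    then obtain b where "b \<in> T" "x = laurent_monomial N b" by auto
    then have "laurent_monomial N a * x \<in> laurent_polys N U"
      using sum[OF a] laurent_polys_monomial[of "a + b" U N] by (simp add: laurent_monomial_add)
    then have "rconst c * (laurent_monomial N a * x) + laurent_monomial N a * y \<in> laurent_polys N U"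
      using step by (intro laurent_polys_add laurent_polys_scale)
    then show ?case by (simp add: algebra_simps)
  qed
  show ?thesis
    using assms(1) unfolding laurent_polys_def[of N S]
  proof (induction rule: kspace.span_induct_alt)
    case base
    then show ?case by (simp add: laurent_polys_0)
  next
    case (step c x y)
    then have "x * q \<in> laurent_polys N U" using * by auto
    then have "rconst c * (x * q) + y * q \<in> laurent_polys N U"
      using step by (intro laurent_polys_add laurent_polys_scale)
    then show ?case by (simp add: algebra_simps)
  qed
qed

text \<open>The subgroups of \<open>\<int>\<^sup>N\<close>, in terms of the addition of the type, so that no group structure
  has to be carried through the computations with exponents.\<close>

definition sublattice :: "nat \<Rightarrow> (nat \<Rightarrow>\<^sub>0 int) set \<Rightarrow> bool" where
  "sublattice N M \<longleftrightarrow> (\<forall>a\<in>M. Poly_Mapping.keys a \<subseteq> {..<N}) \<and> 0 \<in> M \<and>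
     (\<forall>a\<in>M. \<forall>b\<in>M. a + b \<in> M) \<and> (\<forall>a\<in>M. - a \<in> M)"

lemma sublatticeD:
  assumes "sublattice N M"
  shows "a \<in> M \<Longrightarrow> Poly_Mapping.keys a \<subseteq> {..<N}" "0 \<in> M"
    "a \<in> M \<Longrightarrow> b \<in> M \<Longrightarrow> a + b \<in> M" "a \<in> M \<Longrightarrow> - a \<in> M" "a \<in> M \<Longrightarrow> b \<in> M \<Longrightarrow> a - b \<in> M"
proof -
  show "a - b \<in> M" if "a \<in> M" "b \<in> M"
    using assms that unfolding sublattice_def by (metis add_uminus_conv_diff)
qed (use assms in \<open>auto simp: sublattice_def\<close>)

lemma monomial_field_is_subfield: "subfield (monomial_field N S) type_ring"
  unfolding monomial_field_def by (rule gen_subfield_is_subfield)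

lemma laurent_monomial_in_field: "a \<in> S \<Longrightarrow> laurent_monomial N a \<in> monomial_field N S"
  unfolding monomial_field_def using subset_gen_subfield by blast

lemma rconst_in_monomial_field: "rconst c \<in> monomial_field N S"
  unfolding monomial_field_def by (rule rconst_in_gen_subfield)

lemma monomial_field_least:
  assumes "subfield F type_ring" "rconsts \<subseteq> F" "\<And>a. a \<in> S \<Longrightarrow> laurent_monomial N a \<in> F"
  shows "monomial_field N S \<subseteq> F"
  unfolding monomial_field_def using assms by (intro gen_subfield_least) auto

lemma monomial_field_mono: "S \<subseteq> T \<Longrightarrow> monomial_field N S \<subseteq> monomial_field N T"
  by (rule monomial_field_least[OF monomial_field_is_subfield])
    (auto simp: rconsts_eq rconst_in_monomial_field laurent_monomial_in_field)

text \<open>The quotients of Laurent polynomials supported on \<open>M\<close> already form a field.\<close>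

lemma monomial_field_denominator:
  assumes M: "sublattice N M" and k: "k \<in> monomial_field N M"
  obtains D where "D \<in> laurent_polys N M" "D \<noteq> 0" "D * k \<in> laurent_polys N M"
proof -
  let ?P = "laurent_polys N M :: 'a ratfun set"
  define Q where "Q = {p / q | p q. p \<in> ?P \<and> q \<in> ?P \<and> q \<noteq> 0}"
  have mult: "p * q \<in> ?P" if "p \<in> ?P" "q \<in> ?P" for p q
    using laurent_polys_mult[OF that] sublatticeD(3)[OF M] by blast
  have one: "1 \<in> ?P" using laurent_polys_monomial[OF sublatticeD(2)[OF M], of N] by simp
  have const: "rconst c \<in> ?P" for c using laurent_polys_scale[OF one] by simp
  have emb: "p \<in> Q" if "p \<in> ?P" for p
    unfolding Q_def mem_Collect_eq by (rule exI[of _ p], rule exI[of _ 1]) (use that one in simp)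
  have "subfield Q type_ring"
  proof (rule type_subfieldI)
    show "1 \<in> Q" by (rule emb[OF one])
    fix a assume "a \<in> Q"
    then obtain p q where a: "a = p / q" "p \<in> ?P" "q \<in> ?P" "q \<noteq> 0" unfolding Q_def by blast
    have "rconst (-1) * p \<in> ?P" using a by (intro laurent_polys_scale)
    then have "- p \<in> ?P" by (simp add: rconst_uminus)
    moreover have "- a = (- p) / q" using a by simp
    ultimately show "- a \<in> Q" unfolding Q_def using a by blast
    show "inverse a \<in> Q" if "a \<noteq> 0"
      unfolding Q_def mem_Collect_eq by (rule exI[of _ q], rule exI[of _ p]) (use a that in auto)
    fix b assume "b \<in> Q"
    then obtain r s where b: "b = r / s" "r \<in> ?P" "s \<in> ?P" "s \<noteq> 0" unfolding Q_def by blast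
    have "a * b = (p * r) / (q * s)" "a + b = (p * s + r * q) / (q * s)"
      using a b by (auto simp: field_simps)
    moreover have "p * r \<in> ?P" "q * s \<in> ?P" "p * s + r * q \<in> ?P" "q * s \<noteq> 0"
      using a b mult by (auto intro!: laurent_polys_add)
    ultimately show "a * b \<in> Q" "a + b \<in> Q" unfolding Q_def by blast+
  qed
  then have "monomial_field N M \<subseteq> Q"
    by (rule monomial_field_least) (auto simp: rconsts_eq intro!: emb const laurent_polys_monomial)
  then obtain p q where "k = p / q" "p \<in> ?P" "q \<in> ?P" "q \<noteq> 0" using k unfolding Q_def by blast
  then show thesis by (intro that[of q]) auto
qed

text \<open>Clearing denominators in a combination of the monomials \<open>x\<^sup>a\<close> with coefficients in the field
  of \<open>M\<close> gives a Laurent polynomial supported on the cosets \<open>a + M\<close>.\<close>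

lemma Span_monomials_denominator:
  assumes M: "sublattice N M"
    and "v \<in> R.Span (monomial_field N M) (map (laurent_monomial N) as)"
  shows "\<exists>D\<in>laurent_polys N M. D \<noteq> 0 \<and> D * v \<in> laurent_polys N {a + m | a m. a \<in> set as \<and> m \<in> M}"
  using assms(2)
proof (induction as arbitrary: v)
  case Nil
  then show ?case using laurent_polys_monomial[OF sublatticeD(2)[OF M], of N]
    by (intro bexI[of _ 1]) (auto simp: laurent_polys_0)
next
  case (Cons a as)
  let ?C = "\<lambda>as. {a + m | a m. a \<in> set as \<and> m \<in> M}"
  obtain k w where k: "k \<in> monomial_field N M" and v: "v = k * laurent_monomial N a + w"
    and "w \<in> R.Span (monomial_field N M) (map (laurent_monomial N) as)"
    using Cons(2) unfolding list.map Span_Cons_iff by blast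
  then obtain D where D: "D \<in> laurent_polys N M" "D \<noteq> 0" "D * w \<in> laurent_polys N (?C as)"
    using Cons(1) by blast
  obtain D' where D': "D' \<in> laurent_polys N M" "D' \<noteq> 0" "D' * k \<in> laurent_polys N M"
    using monomial_field_denominator[OF M k] .
  have DD: "D * D' \<in> laurent_polys N M"
    by (rule laurent_polys_mult[OF D(1) D'(1)]) (rule sublatticeD(3)[OF M])
  have "D * (D' * k) \<in> laurent_polys N M"
    by (rule laurent_polys_mult[OF D(1) D'(3)]) (rule sublatticeD(3)[OF M])
  then have 1: "(D * (D' * k)) * laurent_monomial N a \<in> laurent_polys N (?C (a # as))"
    by (rule laurent_polys_mult[OF _ laurent_polys_monomial[of a "{a}"]])
      (auto simp: add.commute intro: exI[of _ a])
  have 2: "D' * (D * w) \<in> laurent_polys N (?C (a # as))"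
  proof (rule laurent_polys_mult[OF D'(1) D(3)])
    fix m b assume m: "m \<in> M" and "b \<in> ?C as"
    then obtain c n where c: "c \<in> set as" "n \<in> M" "b = c + n" by blast
    have "m + b = c + (m + n)" "m + n \<in> M"
      using c m sublatticeD(3)[OF M] by (auto simp: algebra_simps)
    then show "m + b \<in> ?C (a # as)" using c(1) unfolding mem_Collect_eq
      by (intro exI[of _ c] exI[of _ "m + n"]) auto
  qed
  have "(D * D') * v \<in> laurent_polys N (?C (a # as))"
    using laurent_polys_add[OF 1 2] by (simp add: v algebra_simps)
  then show ?case using DD D(2) D'(2) by (intro bexI[of _ "D * D'"]) auto
qed

text \<open>Distinct cosets have disjoint supports, so a relation between coset representatives would
  be a relation between Laurent monomials.\<close>

lemma independent_coset_monomials: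
  assumes M: "sublattice N M" and as: "\<And>a. a \<in> set as \<Longrightarrow> Poly_Mapping.keys a \<subseteq> {..<N}"
    and "sorted_wrt (\<lambda>a b. a - b \<notin> M) as"
  shows "R.independent (monomial_field N M :: 'k::field ratfun set) (map (laurent_monomial N) as)"
  using as assms(3)
proof (induction as)
  case (Cons a as)
  let ?C = "{b + m | b m. b \<in> set as \<and> m \<in> M}" and ?x = "laurent_monomial N :: _ \<Rightarrow> 'k ratfun"
  have "?x a \<notin> R.Span (monomial_field N M) (map ?x as)"
  proof
    assume "?x a \<in> R.Span (monomial_field N M) (map ?x as)"
    then obtain D where D: "D \<in> laurent_polys N M" "D \<noteq> 0" "D * ?x a \<in> laurent_polys N ?C"
      using Span_monomials_denominator[OF M] by blast
    have D': "D * ?x a \<in> laurent_polys N ((+) a ` M)"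
      by (rule laurent_polys_mult[OF D(1) laurent_polys_monomial[of a "{a}"]])
        (auto simp: add.commute)
    let ?Z = "{e. Poly_Mapping.keys e \<subseteq> {..<N}}"
    have Z: "e + m \<in> ?Z" if "e \<in> set (a # as)" "m \<in> M" for e m
      using Cons.prems(1)[OF that(1)] sublatticeD(1)[OF M that(2)] Poly_Mapping.keys_add[of e m] by blast
    have sub: "?x ` (+) a ` M \<subseteq> ?x ` ?Z" "?x ` ?C \<subseteq> ?x ` ?Z"
      using Z by (auto intro!: imageI)
    have "?x ` (+) a ` M \<inter> ?x ` ?C = {}"
    proof (rule ccontr)
      assume "?x ` (+) a ` M \<inter> ?x ` ?C \<noteq> {}"
      then obtain m b n where mbn: "m \<in> M" "b \<in> set as" "n \<in> M" "?x (a + m) = ?x (b + n)"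
        by blast
      then have "a + m = b + n"
        using Z[of a m] Z[of b n] laurent_monomial_inj[of "a + m" N "b + n"] by auto
      then have "a - b = n - m" by (simp add: algebra_simps)
      then have "a - b \<in> M" using sublatticeD(5)[OF M mbn(3,1)] by simp
      then show False using Cons.prems(2) mbn by auto
    qed
    then have "D * ?x a = 0"
      using kspace.span_disjoint_Int[OF laurent_monomials_independent sub] D' D(3)
      unfolding laurent_polys_def by blast
    then show False using D(2) by simp
  qed
  moreover have "R.independent (monomial_field N M) (map ?x as)" using Cons by auto
  ultimately show ?case by (simp add: R.independent.li_Cons)
qed simp

text \<open>The span of a full set of coset representatives is closed under multiplication, since
  \<open>x\<^sup>a x\<^sup>b = x\<^sup>m x\<^sup>c\<close> where \<open>c\<close> represents the coset of \<open>a + b = m + c\<close>; being finite-dimensional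
  it is a field.\<close>

lemma Span_coset_monomials:
  assumes M: "sublattice N M" and L: "sublattice N L" and "M \<subseteq> L"
    and as: "set as \<subseteq> L" "sorted_wrt (\<lambda>a b. a - b \<notin> M) as"
    and full: "\<And>l. l \<in> L \<Longrightarrow> \<exists>a\<in>set as. l - a \<in> M"
  shows "R.Span (monomial_field N M) (map (laurent_monomial N) as)
       = (monomial_field N L :: 'k::field ratfun set)"
proof
  let ?x = "laurent_monomial N :: _ \<Rightarrow> 'k ratfun"
  let ?K = "monomial_field N M :: 'k ratfun set"
  let ?E = "monomial_field N L :: 'k ratfun set"
  define W where "W = R.Span ?K (map ?x as)"
  note K = monomial_field_is_subfield[of N M, where ?'a = 'k]
  note E = monomial_field_is_subfield[of N L, where ?'a = 'k]
  have dim: "R.dimension (length (map ?x as)) ?K W"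
    unfolding W_def using sublatticeD(1)[OF L] as
    by (intro R.dimension_independent independent_coset_monomials[OF M]) auto
  note W = R.space_subgroup_props[OF K dim, simplified]
  have base: "?x a \<in> W" if "a \<in> set as" for a
    using R.Span_base_incl[OF K, of "map ?x as"] that unfolding W_def by auto
  have mono: "?x l \<in> W" if l: "l \<in> L" for l
  proof -
    obtain a where a: "a \<in> set as" "l - a \<in> M" using full[OF l] by blast
    have "?x (l - a) * ?x a \<in> W" using a base by (intro W(5)) (simp_all add: laurent_monomial_in_field)
    then show ?thesis by (simp flip: laurent_monomial_add)
  qed
  have span_induct: "P v"
    if "v \<in> W" and "P 0" and step: "\<And>k a w. k \<in> ?K \<Longrightarrow> a \<in> set as \<Longrightarrow> P w \<Longrightarrow> P (k * ?x a + w)" for P v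
  proof -
    have "P v" if "v \<in> R.Span ?K (map ?x bs)" "set bs \<subseteq> set as" for bs
      using that
    proof (induction bs arbitrary: v)
      case Nil
      then show ?case using \<open>P 0\<close> by simp
    next
      case (Cons b bs)
      then show ?case unfolding list.map Span_Cons_iff using step by fastforce
    qed
    then show ?thesis using that(1) unfolding W_def by blast
  qed
  have mult: "u * v \<in> W" if "u \<in> W" "v \<in> W" for u v
  proof (rule span_induct[OF that(1)])
    fix k a w assume *: "k \<in> ?K" "a \<in> set as" "w * v \<in> W"
    have "?x a * v \<in> W"
    proof (rule span_induct[OF that(2)])
      fix k b w assume "k \<in> ?K" "b \<in> set as" "?x a * w \<in> W"
      moreover have "?x a * ?x b \<in> W"
        using mono[of "a + b"] calculation *(2) as(1) sublatticeD(3)[OF L, of a b]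
        by (auto simp: laurent_monomial_add)
      ultimately have "k * (?x a * ?x b) + ?x a * w \<in> W" by (intro W(3)[OF W(5)])
      then show "?x a * (k * ?x b + w) \<in> W" by (simp add: algebra_simps)
    qed (simp add: W)
    then have "k * (?x a * v) + w * v \<in> W" using * by (intro W(3)[OF W(5)])
    then show "(k * ?x a + w) * v \<in> W" by (simp add: algebra_simps)
  qed (simp add: W)
  have one: "1 \<in> W" using mono[OF sublatticeD(2)[OF L]] by simp
  have "subfield W type_ring"
    by (rule finite_dimensional_subring_is_subfield[OF K dim one mult])
  moreover have "rconst c \<in> W" for c
    using W(5)[OF rconst_in_monomial_field one, of c] by simp
  ultimately show "?E \<subseteq> R.Span ?K (map ?x as)"
    using mono unfolding W_def by (intro monomial_field_least) (auto simp: rconsts_eq)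
  have KE: "?K \<subseteq> ?E" by (rule monomial_field_mono) fact
  have "v \<in> ?E" if "v \<in> W" for v
  proof (rule span_induct[OF that])
    fix k a w assume "k \<in> ?K" "a \<in> set as" "w \<in> ?E"
    then show "k * ?x a + w \<in> ?E"
      using KE as(1) by (intro type_subfield_simps[OF E]) (auto intro: laurent_monomial_in_field)
  qed (simp add: type_subfield_simps[OF E])
  then show "R.Span ?K (map ?x as) \<subseteq> ?E" unfolding W_def by blast
qed

subsection \<open>The degree is the index\<close>

definition coset :: "(nat \<Rightarrow>\<^sub>0 int) set \<Rightarrow> (nat \<Rightarrow>\<^sub>0 int) \<Rightarrow> (nat \<Rightarrow>\<^sub>0 int) set" where
  "coset M a = (\<lambda>m. m + a) ` M"

lemma rcosets_eq: "rcosets\<^bsub>(Z_pow N)\<lparr>carrier := L\<rparr>\<^esub> M = coset M ` L"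
  by (auto simp: RCOSETS_def r_coset_def coset_def free_Abelian_group_def)

lemma coset_eq_iff:
  assumes "sublattice N M"
  shows "coset M a = coset M b \<longleftrightarrow> a - b \<in> M"
proof
  assume "coset M a = coset M b"
  then have "0 + a \<in> coset M b" unfolding coset_def using sublatticeD(2)[OF assms] by blast
  then show "a - b \<in> M" by (auto simp: coset_def)
next
  assume ab: "a - b \<in> M"
  have sub: "coset M a \<subseteq> coset M b" if "a - b \<in> M" for a b
  proof
    fix e assume "e \<in> coset M a"
    then obtain m where m: "m \<in> M" "e = m + a" by (auto simp: coset_def)
    then have "e = (m + (a - b)) + b" "m + (a - b) \<in> M"
      using that sublatticeD(3)[OF assms] by auto
    then show "e \<in> coset M b" unfolding coset_def by blast
  qed
  have "b - a \<in> M" using sublatticeD(4)[OF assms ab] by simp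
  then show "coset M a = coset M b" using sub ab by blast
qed

text \<open>Lists are used for the representatives because dimensions are counted along lists of vectors; the
  ordering condition says that they are pairwise incongruent, and serves as it stands in an
  induction on the list.\<close>

lemma coset_representatives:
  assumes M: "sublattice N M" and "finite C" "C \<subseteq> coset M ` L"
  shows "\<exists>as. length as = card C \<and> set as \<subseteq> L \<and> sorted_wrt (\<lambda>a b. a - b \<notin> M) as
            \<and> coset M ` set as = C"
  using assms(2,3)
proof (induction C rule: finite_induct)
  case empty
  show ?case by (rule exI[of _ "[]"]) simp
next
  case (insert c C)
  then obtain as where as: "length as = card C" "set as \<subseteq> L"
    "sorted_wrt (\<lambda>a b. a - b \<notin> M) as" "coset M ` set as = C" by auto
  obtain a where a: "a \<in> L" "c = coset M a" using insert by auto
  have "a - b \<notin> M" if "b \<in> set as" for b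
    using insert(2) as(4) that unfolding a(2) coset_eq_iff[OF M, symmetric] by auto
  then show ?case using as a insert by (intro exI[of _ "a # as"]) auto
qed

theorem monomial_fields_dimension:
  assumes M: "sublattice N M" and L: "sublattice N L" and sub: "M \<subseteq> L"
    and fin: "finite (coset M ` L)"
  shows "R.dimension (card (coset M ` L)) (monomial_field N M)
           (monomial_field N L :: 'k::field ratfun set)"
proof -
  obtain as where as: "length as = card (coset M ` L)" "set as \<subseteq> L"
    "sorted_wrt (\<lambda>a b. a - b \<notin> M) as" "coset M ` set as = coset M ` L"
    using coset_representatives[OF M fin] by blast
  have full: "\<exists>a\<in>set as. l - a \<in> M" if "l \<in> L" for l
  proof -
    have "coset M l \<in> coset M ` set as" using as(4) that by blast
    then show ?thesis by (auto simp: coset_eq_iff[OF M])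
  qed
  have "R.independent (monomial_field N M :: 'k ratfun set) (map (laurent_monomial N) as)"
    by (rule independent_coset_monomials[OF M sublatticeD(1)[OF L] as(3)]) (use as(2) in blast)
  then show ?thesis
    using R.dimension_independent Span_coset_monomials[OF M L sub as(2,3) full] as(1)
    by (metis length_map)
qed

theorem monomial_fields_infinite_dimension:
  assumes M: "sublattice N M" and L: "sublattice N L" and inf: "infinite (coset M ` L)"
  shows "\<not> R.finite_dimension (monomial_field N M) (monomial_field N L :: 'k::field ratfun set)"
proof
  let ?K = "monomial_field N M :: 'k ratfun set"
  assume "R.finite_dimension ?K (monomial_field N L :: 'k ratfun set)"
  then obtain n where n: "R.dimension n ?K (monomial_field N L :: 'k ratfun set)"
    by (auto simp: R.finite_dimension_def)
  obtain C where C: "card C = Suc n" "finite C" "C \<subseteq> coset M ` L"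
    using infinite_arbitrarily_large[OF inf] by metis
  obtain as where as: "length as = Suc n" "set as \<subseteq> L" "sorted_wrt (\<lambda>a b. a - b \<notin> M) as"
    using coset_representatives[OF M C(2,3)] C(1) by auto
  have "R.independent ?K (map (laurent_monomial N) as)"
    by (rule independent_coset_monomials[OF M sublatticeD(1)[OF L] as(3)]) (use as(2) in blast)
  then have "length (map (laurent_monomial N :: _ \<Rightarrow> 'k ratfun) as) \<le> n"
    by (rule R.independent_length_le_dimension[OF monomial_field_is_subfield n])
      (use as in \<open>auto intro: laurent_monomial_in_field\<close>)
  then show False using as by simp
qed

text \<open>For \<open>a\<close> in \<open>L\<close> but not in \<open>M\<close> the monomials \<open>x\<^sup>a\<close> and \<open>1\<close> are independent, so the
  larger field cannot be one-dimensional over the smaller one.\<close>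

lemma monomial_field_eq_iff:
  assumes M: "sublattice N M" and L: "sublattice N L" and sub: "M \<subseteq> L"
  shows "(monomial_field N M :: 'k::field ratfun set) = monomial_field N L \<longleftrightarrow> M = L"
proof
  let ?K = "monomial_field N M :: 'k ratfun set"
  assume eq: "?K = monomial_field N L"
  show "M = L"
  proof (rule ccontr)
    assume "M \<noteq> L"
    then obtain a where a: "a \<in> L" "a \<notin> M" using sub by blast
    have "R.independent ?K (map (laurent_monomial N) [a, 0])"
      using a sublatticeD(1,2)[OF L] by (intro independent_coset_monomials[OF M]) auto
    then have "length (map (laurent_monomial N :: _ \<Rightarrow> 'k ratfun) [a, 0]) \<le> 1"
    proof (rule R.independent_length_le_dimension[OF monomial_field_is_subfield
          R.dimension_one[OF monomial_field_is_subfield]])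
      show "set (map (laurent_monomial N) [a, 0]) \<subseteq> ?K"
        using a sublatticeD(2)[OF L] unfolding eq by (auto intro!: laurent_monomial_in_field simp del: laurent_monomial_0)
    qed
    then show False by simp
  qed
qed simp

section \<open>Rank and index of lattices\<close>

interpretation zmod: Modules.module "frag_cmul :: int \<Rightarrow> (nat \<Rightarrow>\<^sub>0 int) \<Rightarrow> _"
  by unfold_locales (simp_all add: frag_cmul_distrib frag_cmul_distrib2)

interpretation fun_space: vector_space "fun_scale :: 'k::field \<Rightarrow> ('v \<Rightarrow> 'k) \<Rightarrow> _"
  by unfold_locales (auto simp: fun_scale_def plus_fun_def algebra_simps)

lemma sublattice_sum:
  assumes "sublattice N M" "\<And>i. i \<in> I \<Longrightarrow> f i \<in> M"
  shows "sum f I \<in> M"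
  using assms(2)
  by (induction I rule: infinite_finite_induct) (auto intro: sublatticeD[OF assms(1)])

lemma sublattice_cmul:
  assumes "sublattice N M" "a \<in> M"
  shows "frag_cmul n a \<in> M"
proof -
  have nat: "frag_cmul (int k) a \<in> M" for k
    by (induction k) (auto simp: frag_cmul_distrib assms sublatticeD[OF assms(1)])
  show ?thesis
  proof (cases "0 \<le> n")
    case True
    then show ?thesis using nat[of "nat n"] by simp
  next
    case False
    then have "- frag_cmul (int (nat (- n))) a = frag_cmul n a"
      unfolding minus_frag_cmul by simp
    then show ?thesis by (rule subst) (rule sublatticeD(4)[OF assms(1) nat])
  qed
qed

lemma common_denominator:
  fixes u :: "'a \<Rightarrow> rat"
  assumes "finite A"
  shows "\<exists>D::int. D > 0 \<and> (\<forall>a\<in>A. \<exists>k::int. of_int D * u a = of_int k)"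
  using assms
proof (induction A rule: finite_induct)
  case empty
  show ?case by (rule exI[of _ 1]) simp
next
  case (insert b A)
  then obtain D :: int where D: "D > 0" "\<And>a. a \<in> A \<Longrightarrow> \<exists>k::int. of_int D * u a = of_int k"
    by blast
  obtain p q :: int where pq: "q > 0" "u b = of_int p / of_int q"
    by (metis quotient_of_denom_pos quotient_of_div surj_pair)
  have "\<exists>k::int. of_int (D * q) * u a = of_int k" if "a \<in> insert b A" for a
  proof (cases "a = b")
    case True
    then show ?thesis using pq by (intro exI[of _ "D * p"]) simp
  next
    case False
    then have "a \<in> A" using that by simp
    then obtain k :: int where "of_int D * u a = of_int k" using D(2) by blast
    then have "of_int (D * q) * u a = of_int (k * q)" by (simp add: algebra_simps)
    then show ?thesis by blast
  qed
  then show ?case using D(1) pq(1) by (intro exI[of _ "D * q"]) auto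
qed

text \<open>Integral independence implies rational independence, by clearing denominators; hence an
  independent family in \<open>\<int>\<^sup>N\<close> has at most \<open>N\<close> members.\<close>

lemma card_independent_le:
  assumes B: "\<And>b. b \<in> B \<Longrightarrow> Poly_Mapping.keys b \<subseteq> {..<N}" and ind: "\<not> zmod.dependent B"
  shows "card B \<le> N"
proof -
  define \<phi> :: "(nat \<Rightarrow>\<^sub>0 int) \<Rightarrow> nat \<Rightarrow> rat" where "\<phi> a i = of_int (Poly_Mapping.lookup a i)" for a i
  define e :: "nat \<Rightarrow> nat \<Rightarrow> rat" where "e i = (\<lambda>j. if j = i then 1 else 0)" for i
  have inj: "inj \<phi>"
    by (rule injI) (auto simp: \<phi>_def fun_eq_iff poly_mapping_eq_iff)
  have sum_eval: "(\<Sum>a\<in>A. f a) i = (\<Sum>a\<in>A. f a i)" for f :: "'z \<Rightarrow> nat \<Rightarrow> rat" and A i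
    by (induction A rule: infinite_finite_induct) auto
  have "fun_space.independent (\<phi> ` B)"
    unfolding fun_space.independent_explicit_module
  proof (intro allI impI)
    fix t u v assume t: "finite t" "t \<subseteq> \<phi> ` B" and s0: "(\<Sum>v\<in>t. fun_scale (u v) v) = 0" and v: "v \<in> t"
    obtain A where A: "A \<subseteq> B" "t = \<phi> ` A" using t(2) by (metis subset_imageE)
    have fA: "finite A" using t(1) A inj by (metis finite_imageD inj_on_subset subset_UNIV)
    obtain D :: int where D: "D > 0" "\<forall>w\<in>t. \<exists>k::int. of_int D * u w = of_int k"
      using common_denominator[OF t(1)] by blast
    then obtain k :: "_ \<Rightarrow> int" where k: "\<And>w. w \<in> t \<Longrightarrow> of_int D * u w = of_int (k w)" by metis
    have "Poly_Mapping.lookup (\<Sum>a\<in>A. frag_cmul (k (\<phi> a)) a) i = 0" for i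
    proof -
      have "(0::rat) = of_int D * (\<Sum>a\<in>A. fun_scale (u (\<phi> a)) (\<phi> a)) i"
        using s0 inj unfolding A(2) by (subst (asm) sum.reindex) (auto intro: inj_on_subset)
      also have "\<dots> = (\<Sum>a\<in>A. of_int D * u (\<phi> a) * \<phi> a i)"
        by (simp add: sum_eval fun_scale_def sum_distrib_left mult.assoc)
      also have "\<dots> = (\<Sum>a\<in>A. of_int (k (\<phi> a) * Poly_Mapping.lookup a i))"
        by (rule sum.cong) (use k A in \<open>auto simp: \<phi>_def\<close>)
      also have "\<dots> = of_int (Poly_Mapping.lookup (\<Sum>a\<in>A. frag_cmul (k (\<phi> a)) a) i)"
        by (simp add: lookup_sum)
      finally show ?thesis by simp
    qed
    then have "(\<Sum>a\<in>A. frag_cmul (k (\<phi> a)) a) = 0" by (simp add: poly_mapping_eqI)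
    then have "k (\<phi> a) = 0" if "a \<in> A" for a
      using zmod.independentD[OF ind fA A(1), of "\<lambda>a. k (\<phi> a)"] that by blast
    then have "k v = 0" using v A(2) by auto
    then show "u v = 0" using k[OF v] D(1) by simp
  qed
  moreover have "\<phi> ` B \<subseteq> fun_space.span (e ` {..<N})"
  proof (rule image_subsetI)
    fix b assume b: "b \<in> B"
    have "\<phi> b = (\<Sum>i<N. fun_scale (\<phi> b i) (e i))"
    proof
      fix j
      have "(\<Sum>i<N. fun_scale (\<phi> b i) (e i)) j = (\<Sum>i<N. if i = j then \<phi> b j else 0)"
        unfolding sum_eval by (rule sum.cong) (auto simp: fun_scale_def e_def)
      also have "\<dots> = \<phi> b j"
        using subsetD[OF B[OF b], of j] in_keys_iff[of j b] by (auto simp: \<phi>_def)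
      finally show "\<phi> b j = (\<Sum>i<N. fun_scale (\<phi> b i) (e i)) j" ..
    qed
    then show "\<phi> b \<in> fun_space.span (e ` {..<N})"
      by (metis (no_types, lifting) fun_space.span_base fun_space.span_scale fun_space.span_sum imageI)
  qed
  ultimately have "card (\<phi> ` B) \<le> card (e ` {..<N})"
    using fun_space.independent_span_bound[of "e ` {..<N}" "\<phi> ` B"] by simp
  also have "\<dots> \<le> N" using card_image_le[of "{..<N}" e] by simp
  finally show ?thesis using card_image[OF inj_on_subset[OF inj]] by (metis subset_UNIV)
qed

context
  fixes N L assumes L: "sublattice N L"
begin

lemma finite_independent_cards:
  "finite {card B | B. B \<subseteq> L \<and> finite B \<and> \<not> zmod.dependent B}"
proof (rule finite_subset)
  show "{card B | B. B \<subseteq> L \<and> finite B \<and> \<not> zmod.dependent B} \<subseteq> {..N}"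
    using card_independent_le[of _ N] sublatticeD(1)[OF L] by blast
qed simp

lemma card_le_lattice_rank:
  "B \<subseteq> L \<Longrightarrow> finite B \<Longrightarrow> \<not> zmod.dependent B \<Longrightarrow> card B \<le> lattice_rank L"
  unfolding lattice_rank_def by (rule Max_ge[OF finite_independent_cards]) blast

lemma lattice_rank_attained:
  obtains B where "B \<subseteq> L" "finite B" "\<not> zmod.dependent B" "card B = lattice_rank L"
proof -
  have "lattice_rank L \<in> {card B | B. B \<subseteq> L \<and> finite B \<and> \<not> zmod.dependent B}"
    unfolding lattice_rank_def
    by (rule Max_in[OF finite_independent_cards]) (use zmod.independent_empty in blast)
  then show thesis using that by auto
qed

end

text \<open>If the ranks agree, a maximal independent family \<open>B\<close> of \<open>M\<close> cannot be enlarged in \<open>L\<close>, and a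
  relation between \<open>B\<close> and \<open>a\<close> expresses a multiple of \<open>a\<close> through \<open>B\<close>. Conversely, a common
  multiple moves an independent family of \<open>L\<close> into \<open>M\<close>.\<close>

lemma lattice_rank_eq_iff:
  fixes M L :: "(nat \<Rightarrow>\<^sub>0 int) set"
  assumes M: "sublattice N M" and L: "sublattice N L" and sub: "M \<subseteq> L"
  shows "lattice_rank M = lattice_rank L \<longleftrightarrow> (\<forall>a\<in>L. \<exists>n>0. frag_cmul n a \<in> M)"
proof
  assume eq: "lattice_rank M = lattice_rank L"
  obtain B where B: "B \<subseteq> M" "finite B" "\<not> zmod.dependent B" "card B = lattice_rank M"
    using lattice_rank_attained[OF M] .
  show "\<forall>a\<in>L. \<exists>n>0. frag_cmul n a \<in> M"
  proof
    fix a assume a: "a \<in> L"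
    show "\<exists>n>0. frag_cmul n a \<in> M"
    proof (cases "a \<in> B")
      case True
      then show ?thesis using B by (intro exI[of _ 1]) auto
    next
      case False
      have "zmod.dependent (insert a B)"
      proof (rule ccontr)
        assume "\<not> zmod.dependent (insert a B)"
        then have "card (insert a B) \<le> lattice_rank L"
          using B sub a by (intro card_le_lattice_rank[OF L]) auto
        then show False using B False eq by simp
      qed
      then obtain u where u: "\<exists>v\<in>insert a B. u v \<noteq> 0" "(\<Sum>v\<in>insert a B. frag_cmul (u v) v) = 0"
        using zmod.dependent_finite[of "insert a B"] B(2) by auto
      then have s: "frag_cmul (u a) a = - (\<Sum>v\<in>B. frag_cmul (u v) v)"
        using B(2) False by (simp add: add_eq_0_iff2)
      have "u a \<noteq> 0"
      proof
        assume "u a = 0"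
        then have "(\<Sum>v\<in>B. frag_cmul (u v) v) = 0" using s by simp
        then have "\<forall>v\<in>B. u v = 0" using B(2,3) zmod.dependent_finite by blast
        then show False using u(1) \<open>u a = 0\<close> by auto
      qed
      have "frag_cmul (u a) a \<in> M"
        unfolding s using B(1) by (intro sublatticeD(4)[OF M] sublattice_sum[OF M] sublattice_cmul[OF M]) auto
      then have "frag_cmul (sgn (u a)) (frag_cmul (u a) a) \<in> M" by (rule sublattice_cmul[OF M])
      then have "frag_cmul \<bar>u a\<bar> a \<in> M" by (simp add: abs_sgn mult.commute)
      then show ?thesis using \<open>u a \<noteq> 0\<close> by (intro exI[of _ "\<bar>u a\<bar>"]) auto
    qed
  qed
next
  assume "\<forall>a\<in>L. \<exists>n>0. frag_cmul n a \<in> M"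
  then obtain n where n: "\<And>a. a \<in> L \<Longrightarrow> n a > 0" "\<And>a. a \<in> L \<Longrightarrow> frag_cmul (n a) a \<in> M" by metis
  obtain B where B: "B \<subseteq> L" "finite B" "\<not> zmod.dependent B" "card B = lattice_rank L"
    using lattice_rank_attained[OF L] .
  define k where "k = (\<Prod>b\<in>B. n b)"
  have "k > 0" unfolding k_def using B(1) n(1) by (intro prod_pos) auto
  have inj: "inj_on (frag_cmul k) B"
  proof (rule inj_onI)
    fix a b :: "nat \<Rightarrow>\<^sub>0 int" assume "frag_cmul k a = frag_cmul k b"
    then have "frag_cmul k (a - b) = 0" using zmod.scale_right_diff_distrib[of k a b] by simp
    then show "a = b" using \<open>k > 0\<close> by simp
  qed
  have kB: "frag_cmul k ` B \<subseteq> M"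
  proof (rule image_subsetI)
    fix b assume b: "b \<in> B"
    have "k = (\<Prod>c\<in>B - {b}. n c) * n b"
      unfolding k_def using B(2) b by (simp add: prod.remove mult.commute)
    then have "frag_cmul k b = frag_cmul (\<Prod>c\<in>B - {b}. n c) (frag_cmul (n b) b)" by simp
    moreover have "frag_cmul (n b) b \<in> M" using n(2) B(1) b by blast
    ultimately show "frag_cmul k b \<in> M" using sublattice_cmul[OF M] by metis
  qed
  have "\<not> zmod.dependent (frag_cmul k ` B)"
  proof
    assume "zmod.dependent (frag_cmul k ` B)"
    then obtain u where u: "\<exists>v\<in>frag_cmul k ` B. u v \<noteq> 0"
      "(\<Sum>v\<in>frag_cmul k ` B. frag_cmul (u v) v) = 0"
      using zmod.dependent_finite[of "frag_cmul k ` B"] B(2) by auto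
    have "(\<Sum>b\<in>B. frag_cmul (u (frag_cmul k b) * k) b) = 0"
      using u(2) by (simp add: sum.reindex[OF inj])
    then have "\<forall>b\<in>B. u (frag_cmul k b) * k = 0"
      using zmod.independentD[OF B(3,2) order_refl, of "\<lambda>b. u (frag_cmul k b) * k"] by blast
    then show False using u(1) \<open>k > 0\<close> by auto
  qed
  then have "card (frag_cmul k ` B) \<le> lattice_rank M"
    using kB B(2) by (intro card_le_lattice_rank[OF M]) auto
  then have "lattice_rank L \<le> lattice_rank M" using B(4) card_image[OF inj] by simp
  moreover have "lattice_rank M \<le> lattice_rank L"
    using lattice_rank_attained[OF M] card_le_lattice_rank[OF L] sub by (metis order_trans)
  ultimately show "lattice_rank M = lattice_rank L" by simp
qed

text \<open>Two multiples of \<open>a\<close> lie in the same coset by the pigeonhole principle.\<close>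

lemma finite_cosets_imp_torsion:
  assumes M: "sublattice N M" and L: "sublattice N L" and fin: "finite (coset M ` L)" and a: "a \<in> L"
  shows "\<exists>n>0. frag_cmul n a \<in> M"
proof -
  define f where "f k = coset M (frag_cmul (int k) a)" for k
  have "range f \<subseteq> coset M ` L" unfolding f_def using sublattice_cmul[OF L a] by blast
  then have "\<not> inj f" using fin finite_subset finite_imageD infinite_UNIV_nat by metis
  then obtain k l where "k < l" "f l = f k" unfolding inj_def by (metis nat_neq_iff)
  then have "frag_cmul (int l) a - frag_cmul (int k) a \<in> M"
    by (simp add: f_def coset_eq_iff[OF M])
  then have "frag_cmul (int l - int k) a \<in> M" by (simp add: zmod.scale_left_diff_distrib)
  then show ?thesis using \<open>k < l\<close> by (intro exI[of _ "int l - int k"]) auto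
qed

text \<open>Clearing the torsion orders of the vectors \<open>n e\<^sub>i\<close> gives \<open>q > 0\<close> such that \<open>q \<int>\<^sup>N\<close> lies in \<open>M\<close>;
  then every coset is determined by a vector with entries in \<open>{0..<q}\<close>.\<close>

lemma torsion_imp_finite_cosets:
  assumes M: "sublattice N M" and L: "sublattice N L"
    and n: "n > 0" "\<And>i. i < N \<Longrightarrow> Poly_Mapping.single i n \<in> L"
    and tors: "\<And>a. a \<in> L \<Longrightarrow> \<exists>n>0. frag_cmul n a \<in> M"
  shows "finite (coset M ` L)"
proof -
  have "\<forall>i\<in>{..<N}. \<exists>k>0. frag_cmul k (Poly_Mapping.single i n) \<in> M" using tors n(2) by auto
  then obtain k where k: "\<And>i. i < N \<Longrightarrow> k i > 0"
    "\<And>i. i < N \<Longrightarrow> frag_cmul (k i) (Poly_Mapping.single i n) \<in> M" by (metis lessThan_iff)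
  define q where "q = n * (\<Prod>i<N. k i)"
  have "q > 0" unfolding q_def using n(1) k(1) by (intro mult_pos_pos prod_pos) auto
  have cmul_single: "frag_cmul c (Poly_Mapping.single i d) = Poly_Mapping.single i (c * d)" for c d i
    by (rule poly_mapping_eqI) (simp add: lookup_single when_def)
  have single: "Poly_Mapping.single i (c * q) \<in> M" if i: "i < N" for i c
  proof -
    have "q = (\<Prod>j\<in>{..<N} - {i}. k j) * (k i * n)"
      unfolding q_def using i by (simp add: prod.remove[of "{..<N}" i] mult_ac)
    then have "Poly_Mapping.single i (c * q)
      = frag_cmul (c * (\<Prod>j\<in>{..<N} - {i}. k j)) (frag_cmul (k i) (Poly_Mapping.single i n))"
      unfolding cmul_single by (simp add: mult_ac)
    then show ?thesis using sublattice_cmul[OF M k(2)[OF i]] by simp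
  qed
  let ?g = "\<lambda>f. coset M (\<Sum>i<N. Poly_Mapping.single i (f i))"
  have "coset M ` L \<subseteq> ?g ` (PiE {..<N} (\<lambda>_. {0..<q}))"
  proof (rule image_subsetI)
    fix a assume "a \<in> L"
    then have a: "a = (\<Sum>i<N. Poly_Mapping.single i (Poly_Mapping.lookup a i))"
      using poly_eq_sum_single[of "{..<N}" a] sublatticeD(1)[OF L] by simp
    define f where "f = restrict (\<lambda>i. Poly_Mapping.lookup a i mod q) {..<N}"
    have "a - (\<Sum>i<N. Poly_Mapping.single i (f i))
      = (\<Sum>i<N. Poly_Mapping.single i (Poly_Mapping.lookup a i - f i))"
      by (subst a) (simp add: sum_subtractf single_diff)
    also have "\<dots> = (\<Sum>i<N. Poly_Mapping.single i (Poly_Mapping.lookup a i div q * q))"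
      by (rule sum.cong) (auto simp: f_def minus_mod_eq_div_mult)
    also have "\<dots> \<in> M" using single by (intro sublattice_sum[OF M]) auto
    finally have "coset M a = ?g f" by (simp add: coset_eq_iff[OF M])
    moreover have "f \<in> PiE {..<N} (\<lambda>_. {0..<q})" unfolding f_def using \<open>q > 0\<close> by auto
    ultimately show "coset M a \<in> ?g ` (PiE {..<N} (\<lambda>_. {0..<q}))" by blast
  qed
  then show ?thesis by (rule finite_subset) (intro finite_imageI finite_PiE, auto)
qed

section \<open>The action on rational functions\<close>

lemma poly_mult_expand:
  fixes p q :: "'k::field mpoly"
  assumes "finite A" "Poly_Mapping.keys p \<subseteq> A" "finite B" "Poly_Mapping.keys q \<subseteq> B"
  shows "p * q = (\<Sum>m\<in>A. \<Sum>n\<in>B.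
           Poly_Mapping.single (m + n) (Poly_Mapping.lookup p m * Poly_Mapping.lookup q n))"
proof -
  have "p * q = (\<Sum>m\<in>A. Poly_Mapping.single m (Poly_Mapping.lookup p m))
              * (\<Sum>n\<in>B. Poly_Mapping.single n (Poly_Mapping.lookup q n))"
    using poly_eq_sum_single[OF assms(1,2)] poly_eq_sum_single[OF assms(3,4)] by metis
  then show ?thesis by (simp add: sum_product mult_single)
qed

text \<open>Rescaling every monomial by a weight that is multiplicative in the exponent commutes with
  multiplication; this makes the action on polynomials a ring homomorphism.\<close>

lemma lookup_mult_of_weighted:
  fixes p q p' q' :: "'k::field mpoly"
  assumes w: "\<And>m n. w (m + n) = w m * w n"
    and p': "\<And>m. Poly_Mapping.lookup p' m = w m * Poly_Mapping.lookup p m"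
    and q': "\<And>m. Poly_Mapping.lookup q' m = w m * Poly_Mapping.lookup q m"
  shows "Poly_Mapping.lookup (p' * q') k = w k * Poly_Mapping.lookup (p * q) k"
proof -
  let ?A = "Poly_Mapping.keys p" and ?B = "Poly_Mapping.keys q"
  have "Poly_Mapping.keys p' \<subseteq> ?A" "Poly_Mapping.keys q' \<subseteq> ?B"
    using p' q' by (auto simp: in_keys_iff)
  then have "Poly_Mapping.lookup (p' * q') k = (\<Sum>m\<in>?A. \<Sum>n\<in>?B. Poly_Mapping.lookup
      (Poly_Mapping.single (m + n) (Poly_Mapping.lookup p' m * Poly_Mapping.lookup q' n)) k)"
    by (subst poly_mult_expand[of ?A p' ?B q']) (simp_all add: lookup_sum)
  also have "\<dots> = (\<Sum>m\<in>?A. \<Sum>n\<in>?B. w k * Poly_Mapping.lookup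
      (Poly_Mapping.single (m + n) (Poly_Mapping.lookup p m * Poly_Mapping.lookup q n)) k)"
    by (intro sum.cong refl) (auto simp: lookup_single when_def p' q' w)
  also have "\<dots> = w k * Poly_Mapping.lookup (p * q) k"
    by (subst poly_mult_expand[of ?A p ?B q]) (simp_all add: lookup_sum sum_distrib_left)
  finally show ?thesis .
qed

lemma lookup_mult_single:
  fixes p :: "'k::field mpoly"
  shows "Poly_Mapping.lookup (p * Poly_Mapping.single b 1) (m + b) = Poly_Mapping.lookup p m"
proof -
  have "p * Poly_Mapping.single b 1
      = (\<Sum>n\<in>Poly_Mapping.keys p. Poly_Mapping.single (n + b) (Poly_Mapping.lookup p n))"
    by (subst poly_mult_expand[of "Poly_Mapping.keys p" _ "{b}"]) auto
  then have "Poly_Mapping.lookup (p * Poly_Mapping.single b 1) (m + b)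
      = (\<Sum>n\<in>Poly_Mapping.keys p. if n = m then Poly_Mapping.lookup p m else 0)"
    by (auto simp: lookup_sum lookup_single when_def intro!: sum.cong)
  also have "\<dots> = Poly_Mapping.lookup p m" by (auto simp: sum.delta in_keys_iff)
  finally show ?thesis .
qed

lemma rconst_eq_iff [simp]: "rconst c = rconst d \<longleftrightarrow> c = d"
proof
  assume "rconst c = rconst d"
  then have "rconst (c + - d) = 0" unfolding rconst_simps(3) rconst_uminus by simp
  then show "c = d" unfolding rconst_simps(5) by simp
qed simp

lemma rconst_eq_1_iff [simp]: "rconst c = 1 \<longleftrightarrow> c = 1"
  using rconst_eq_iff[of c 1] by simp

lemma pconst_power: "pconst (c ^ n) = pconst c ^ n"
  by (induction n) auto

lemma pconst_prod: "pconst (prod f A) = (\<Prod>i\<in>A. pconst (f i))"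
  by (induction A rule: infinite_finite_induct) auto

lemma ratfunsE:
  assumes "f \<in> ratfuns N"
  obtains p q where "p \<in> polys N" "q \<in> polys N" "q \<noteq> 0" "f = Fraction_Field.Fract p q"
  using assms by (auto simp: ratfuns_def)

lemma ratfunsI:
  "p \<in> polys N \<Longrightarrow> q \<in> polys N \<Longrightarrow> q \<noteq> 0 \<Longrightarrow> Fraction_Field.Fract p q \<in> ratfuns N"
  by (auto simp: ratfuns_def)

lemma ratfuns_add: "f \<in> ratfuns N \<Longrightarrow> h \<in> ratfuns N \<Longrightarrow> f + h \<in> ratfuns N"
  and ratfuns_mult: "f \<in> ratfuns N \<Longrightarrow> h \<in> ratfuns N \<Longrightarrow> f * h \<in> ratfuns N"
  by (auto elim!: ratfunsE intro!: ratfunsI polys_add polys_mult)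

lemma ratfuns_uminus: "f \<in> ratfuns N \<Longrightarrow> - f \<in> ratfuns N"
  by (auto elim!: ratfunsE intro!: ratfunsI polys_uminus)

lemma ratfuns_inverse: "f \<in> ratfuns N \<Longrightarrow> f \<noteq> 0 \<Longrightarrow> inverse f \<in> ratfuns N"
  by (auto elim!: ratfunsE intro!: ratfunsI simp: fract_collapse)

text \<open>The situation in coordinates: the group acts on the \<open>i\<close>-th variable through the character
  \<open>\<chi> _ i\<close>, whose values are \<open>e\<close>-th roots of unity.\<close>

locale diagonal_action =
  fixes G :: "('g, 'm) monoid_scheme" and \<rho> :: "'g \<Rightarrow> 'v \<Rightarrow> 'v" and N :: nat
    and x :: "nat \<Rightarrow> 'v \<Rightarrow> 'k::field" and \<chi> :: "'g \<Rightarrow> nat \<Rightarrow> 'k" and e :: nat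
  assumes lin_form: "g \<in> carrier G \<Longrightarrow> i < N \<Longrightarrow> lin_form_act G \<rho> N x g i = pconst (\<chi> g i) * pvar i"
    and root_of_unity: "g \<in> carrier G \<Longrightarrow> i < N \<Longrightarrow> \<chi> g i ^ e = 1"
    and e_pos: "e > 0"
begin

abbreviation act :: "'g \<Rightarrow> 'k mpoly \<Rightarrow> 'k mpoly" where
  "act \<equiv> poly_act G \<rho> N x"

definition weight :: "'g \<Rightarrow> (nat \<Rightarrow>\<^sub>0 int) \<Rightarrow> 'k" where
  "weight g a = (\<Prod>i<N. \<chi> g i powi Poly_Mapping.lookup a i)"

context
  fixes g assumes g: "g \<in> carrier G"
begin

lemma char_nz: "i < N \<Longrightarrow> \<chi> g i \<noteq> 0"
  using root_of_unity[OF g, of i] e_pos by (auto simp: power_0_left)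

lemma weight_nz [simp]: "weight g a \<noteq> 0"
  using char_nz by (auto simp: weight_def)

lemma weight_add: "weight g (a + b) = weight g a * weight g b"
  unfolding weight_def prod.distrib[symmetric]
  by (rule prod.cong) (auto simp: lookup_add power_int_add char_nz)

lemma weight_uminus: "weight g (- a) = inverse (weight g a)"
  unfolding weight_def prod_inversef[symmetric] by (simp add: power_int_minus)

lemma weight_diff: "weight g (a - b) = weight g a / weight g b"
  using weight_add[of a "- b"] by (simp add: weight_uminus divide_inverse)

lemma lookup_act:
  assumes p: "p \<in> polys N"
  shows "Poly_Mapping.lookup (act g p) m = weight g (int_exp m) * Poly_Mapping.lookup p m"
proof -
  have "act g p = (\<Sum>m\<in>Poly_Mapping.keys p.
          Poly_Mapping.single m (weight g (int_exp m) * Poly_Mapping.lookup p m))"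
    unfolding poly_act_def
  proof (rule sum.cong)
    fix m assume m: "m \<in> Poly_Mapping.keys p"
    have "(\<Prod>i<N. lin_form_act G \<rho> N x g i ^ Poly_Mapping.lookup m i)
        = (\<Prod>i<N. pconst (\<chi> g i ^ Poly_Mapping.lookup m i) * pvar i ^ Poly_Mapping.lookup m i)"
      by (rule prod.cong) (auto simp: lin_form[OF g] power_mult_distrib pconst_power)
    also have "\<dots> = pconst (weight g (int_exp m)) * Poly_Mapping.single m 1"
      by (simp add: prod.distrib prod_pvar_power[OF polys_keys[OF p m]] pconst_prod weight_def)
    finally show "pconst (Poly_Mapping.lookup p m) *
        (\<Prod>i<N. lin_form_act G \<rho> N x g i ^ Poly_Mapping.lookup m i)
      = Poly_Mapping.single m (weight g (int_exp m) * Poly_Mapping.lookup p m)"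
      by (simp add: pconst_def mult_single mult.commute)
  qed simp
  then have "Poly_Mapping.lookup (act g p) m = (\<Sum>n\<in>Poly_Mapping.keys p.
      if n = m then weight g (int_exp m) * Poly_Mapping.lookup p m else 0)"
    by (auto simp: lookup_sum lookup_single when_def intro!: sum.cong)
  also have "\<dots> = weight g (int_exp m) * Poly_Mapping.lookup p m"
    by (auto simp: sum.delta in_keys_iff)
  finally show ?thesis .
qed

lemma keys_act: "p \<in> polys N \<Longrightarrow> Poly_Mapping.keys (act g p) = Poly_Mapping.keys p"
  by (auto simp: in_keys_iff lookup_act)

lemma act_eq_0_iff: "p \<in> polys N \<Longrightarrow> act g p = 0 \<longleftrightarrow> p = 0"
  using keys_act[of p] by (metis keys_eq_empty)

lemma act_add: "p \<in> polys N \<Longrightarrow> q \<in> polys N \<Longrightarrow> act g (p + q) = act g p + act g q"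
  by (rule poly_mapping_eqI) (simp add: lookup_act polys_add lookup_add algebra_simps)

lemma act_uminus: "p \<in> polys N \<Longrightarrow> act g (- p) = - act g p"
  by (rule poly_mapping_eqI) (simp add: lookup_act polys_uminus)

lemma act_mult:
  assumes "p \<in> polys N" "q \<in> polys N"
  shows "act g (p * q) = act g p * act g q"
proof (rule poly_mapping_eqI)
  fix k
  have "Poly_Mapping.lookup (act g p * act g q) k
      = weight g (int_exp k) * Poly_Mapping.lookup (p * q) k"
    by (rule lookup_mult_of_weighted) (simp_all add: lookup_act assms int_exp_add weight_add)
  then show "Poly_Mapping.lookup (act g (p * q)) k = Poly_Mapping.lookup (act g p * act g q) k"
    using lookup_act[OF polys_mult[OF assms]] by simp
qed

lemma act_pconst: "act g (pconst c) = pconst c"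
proof (rule poly_mapping_eqI)
  fix k
  have "weight g (int_exp 0) = 1" by (simp add: weight_def)
  then show "Poly_Mapping.lookup (act g (pconst c)) k = Poly_Mapping.lookup (pconst c) k"
    by (simp add: lookup_act) (simp add: pconst_def lookup_single when_def)
qed

lemma act_single:
  assumes "Poly_Mapping.keys m \<subseteq> {..<N}"
  shows "act g (Poly_Mapping.single m 1) = Poly_Mapping.single m (weight g (int_exp m))"
  by (rule poly_mapping_eqI) (auto simp: lookup_act polys_single assms lookup_single when_def)

lemma rat_act_Fract:
  assumes pq: "p \<in> polys N" "q \<in> polys N" "q \<noteq> 0"
  shows "rat_act G \<rho> N x g (Fraction_Field.Fract p q) = Fraction_Field.Fract (act g p) (act g q)"
  unfolding rat_act_def
proof (rule the_equality)
  show "\<exists>p'\<in>polys N. \<exists>q'\<in>polys N. q' \<noteq> 0 \<and> Fraction_Field.Fract p q = Fraction_Field.Fract p' q' \<and>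
      Fraction_Field.Fract (act g p) (act g q) = Fraction_Field.Fract (act g p') (act g q')"
    using pq by blast
next
  fix h
  assume "\<exists>p'\<in>polys N. \<exists>q'\<in>polys N. q' \<noteq> 0 \<and> Fraction_Field.Fract p q = Fraction_Field.Fract p' q' \<and>
      h = Fraction_Field.Fract (act g p') (act g q')"
  then obtain p' q' where p'q': "p' \<in> polys N" "q' \<in> polys N" "q' \<noteq> 0"
    "Fraction_Field.Fract p q = Fraction_Field.Fract p' q'"
    and h: "h = Fraction_Field.Fract (act g p') (act g q')" by blast
  have "p * q' = p' * q" using p'q'(3,4) pq(3) by (simp add: eq_fract)
  then have "act g (p * q') = act g (p' * q)" by simp
  then have "act g p * act g q' = act g p' * act g q" using act_mult pq p'q' by simp
  then show "h = Fraction_Field.Fract (act g p) (act g q)"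
    unfolding h using pq p'q' by (simp add: eq_fract act_eq_0_iff)
qed

lemma rat_act_add:
  assumes "f \<in> ratfuns N" "h \<in> ratfuns N"
  shows "rat_act G \<rho> N x g (f + h) = rat_act G \<rho> N x g f + rat_act G \<rho> N x g h"
proof -
  obtain p q where f: "p \<in> polys N" "q \<in> polys N" "q \<noteq> 0" "f = Fraction_Field.Fract p q"
    using ratfunsE[OF assms(1)] .
  obtain r s where h: "r \<in> polys N" "s \<in> polys N" "s \<noteq> 0" "h = Fraction_Field.Fract r s"
    using ratfunsE[OF assms(2)] .
  have "f + h = Fraction_Field.Fract (p * s + r * q) (q * s)" using f h by simp
  then show "rat_act G \<rho> N x g (f + h) = rat_act G \<rho> N x g f + rat_act G \<rho> N x g h"
    using f h by (simp_all add: ratfunsI rat_act_Fract act_add act_mult polys_add polys_mult act_eq_0_iff)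
qed

lemma rat_act_mult:
  assumes "f \<in> ratfuns N" "h \<in> ratfuns N"
  shows "rat_act G \<rho> N x g (f * h) = rat_act G \<rho> N x g f * rat_act G \<rho> N x g h"
proof -
  obtain p q where f: "p \<in> polys N" "q \<in> polys N" "q \<noteq> 0" "f = Fraction_Field.Fract p q"
    using ratfunsE[OF assms(1)] .
  obtain r s where h: "r \<in> polys N" "s \<in> polys N" "s \<noteq> 0" "h = Fraction_Field.Fract r s"
    using ratfunsE[OF assms(2)] .
  show "rat_act G \<rho> N x g (f * h) = rat_act G \<rho> N x g f * rat_act G \<rho> N x g h"
    using f h by (simp_all add: ratfunsI rat_act_Fract act_mult polys_mult)
qed

lemma rat_act_uminus:
  assumes "f \<in> ratfuns N"
  shows "rat_act G \<rho> N x g (- f) = - rat_act G \<rho> N x g f"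
proof -
  obtain p q where f: "p \<in> polys N" "q \<in> polys N" "q \<noteq> 0" "f = Fraction_Field.Fract p q"
    using ratfunsE[OF assms] .
  show "rat_act G \<rho> N x g (- f) = - rat_act G \<rho> N x g f"
    using f by (simp_all add: ratfunsI rat_act_Fract act_uminus polys_uminus)
qed

lemma rat_act_inverse:
  assumes "f \<in> ratfuns N" "f \<noteq> 0"
  shows "rat_act G \<rho> N x g (inverse f) = inverse (rat_act G \<rho> N x g f)"
proof -
  obtain p q where f: "p \<in> polys N" "q \<in> polys N" "q \<noteq> 0" "f = Fraction_Field.Fract p q"
    using ratfunsE[OF assms(1)] .
  have "p \<noteq> 0" using f(4) assms(2) by (auto simp: fract_collapse)
  then show "rat_act G \<rho> N x g (inverse f) = inverse (rat_act G \<rho> N x g f)"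
    using f by (simp_all add: ratfunsI rat_act_Fract)
qed

lemma rat_act_rconst: "rat_act G \<rho> N x g (rconst c) = rconst c"
  using rat_act_Fract[of "pconst c" 1] act_pconst[of c] act_pconst[of 1]
  by (simp add: rconst_def to_fract_def)

lemma rat_act_laurent_monomial:
  assumes a: "Poly_Mapping.keys a \<subseteq> {..<N}"
  shows "rat_act G \<rho> N x g (laurent_monomial N a) = rconst (weight g a) * laurent_monomial N a"
proof -
  let ?u = "nat_exp a" and ?v = "nat_exp (- a)"
  have k: "Poly_Mapping.keys ?u \<subseteq> {..<N}" "Poly_Mapping.keys ?v \<subseteq> {..<N}"
    using a keys_nat_exp[of a] keys_nat_exp[of "- a"] by auto
  have "rat_act G \<rho> N x g (laurent_monomial N a) = Fraction_Field.Fract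
      (Poly_Mapping.single ?u (weight g (int_exp ?u))) (Poly_Mapping.single ?v (weight g (int_exp ?v)))"
    unfolding laurent_monomial_as_Fract[OF a] using k
    by (simp add: rat_act_Fract polys_single act_single)
  also have "\<dots> = (rconst (weight g (int_exp ?u)) / rconst (weight g (int_exp ?v)))
      * (laurent_monomial N (int_exp ?u) / laurent_monomial N (int_exp ?v))"
    using k by (simp add: Fract_conv_to_fract to_fract_single)
  also have "rconst (weight g (int_exp ?u)) = rconst (weight g a) * rconst (weight g (int_exp ?v))"
    unfolding rconst_simps(4)[symmetric] weight_add[symmetric]
    using exponent_parts[of a] by (metis diff_add_cancel)
  also have "laurent_monomial N (int_exp ?u) / laurent_monomial N (int_exp ?v) = laurent_monomial N a"
    by (simp add: exponent_parts flip: laurent_monomial_diff)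
  finally show ?thesis by simp
qed

end

lemma inv_field_is_subfield: "subfield (inv_field G \<rho> N x) type_ring"
proof (rule type_subfieldI)
  have "(1 :: 'k ratfun) \<in> ratfuns N"
    using ratfunsI[of 1 N 1] by (simp add: fract_collapse)
  moreover have "rat_act G \<rho> N x g 1 = 1" if "g \<in> carrier G" for g
    using rat_act_rconst[OF that, of 1] by simp
  ultimately show "1 \<in> inv_field G \<rho> N x" by (simp add: inv_field_def)
qed (auto simp: inv_field_def rat_act_add rat_act_mult rat_act_uminus rat_act_inverse
       ratfuns_add ratfuns_mult ratfuns_uminus ratfuns_inverse)

lemma rconst_in_ratfuns: "rconst c \<in> ratfuns N"
  using ratfunsI[of "pconst c" N 1] by (simp add: rconst_def to_fract_def)

lemma rconst_in_inv_field: "rconst c \<in> inv_field G \<rho> N x"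
  by (simp add: inv_field_def rconst_in_ratfuns rat_act_rconst)

lemma inv_lattice_iff:
  "a \<in> inv_lattice G \<rho> N x \<longleftrightarrow>
     Poly_Mapping.keys a \<subseteq> {..<N} \<and> (\<forall>g\<in>carrier G. weight g a = 1)"
  by (auto simp: inv_lattice_def rat_act_laurent_monomial)

lemma laurent_monomial_in_inv_field:
  "a \<in> inv_lattice G \<rho> N x \<Longrightarrow> laurent_monomial N a \<in> inv_field G \<rho> N x"
  by (auto simp: inv_lattice_def inv_field_def laurent_monomial_in_ratfuns)

lemma sublattice_inv_lattice: "sublattice N (inv_lattice G \<rho> N x)"
proof -
  have "weight g 0 = 1" for g by (simp add: weight_def)
  moreover have "Poly_Mapping.keys (a + b) \<subseteq> {..<N}"
    if "Poly_Mapping.keys a \<subseteq> {..<N}" "Poly_Mapping.keys b \<subseteq> {..<N}" for a b :: "nat \<Rightarrow>\<^sub>0 int"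
    using that Poly_Mapping.keys_add[of a b] by blast
  ultimately show ?thesis
    unfolding sublattice_def by (auto simp: inv_lattice_iff weight_add weight_uminus)
qed

text \<open>The lattice of invariant monomials contains \<open>e \<int>\<^sup>N\<close>, which gives it full rank.\<close>

lemma single_in_inv_lattice:
  assumes "i < N"
  shows "Poly_Mapping.single i (int e) \<in> inv_lattice G \<rho> N x"
proof -
  have "weight g (Poly_Mapping.single i (int e)) = 1" if g: "g \<in> carrier G" for g
  proof -
    have "weight g (Poly_Mapping.single i (int e)) = (\<Prod>j<N. if j = i then \<chi> g i ^ e else 1)"
      unfolding weight_def by (rule prod.cong) (auto simp: lookup_single when_def)
    also have "\<dots> = 1" using assms root_of_unity[OF g assms] by simp
    finally show ?thesis .
  qed
  then show ?thesis using assms by (auto simp: inv_lattice_iff)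
qed

text \<open>Among all fractions \<open>f = p / q\<close> whose numerator and denominator use only monomials of a given
  representation, take one with the fewest monomials in \<open>q\<close>. If two monomials of \<open>q\<close> had different
  weights under \<open>g\<close>, then \<open>c q - g q\<close>, with \<open>c\<close> one of these weights, would be a nonzero
  denominator with fewer monomials, and \<open>c p - g p\<close> the corresponding numerator. So \<open>c q - g q\<close>
  vanishes, \<open>c p - g p\<close> vanishes with it, and \<open>p\<close> and \<open>q\<close> are semi-invariants of the same
  weight.\<close>

lemma semi_invariant_representation:
  assumes f: "f \<in> inv_field G \<rho> N x" and f12: "f = Fraction_Field.Fract f1 f2"
    "f1 \<in> polys N" "f2 \<in> polys N" "f2 \<noteq> 0"
  obtains p q where "f = Fraction_Field.Fract p q" "q \<noteq> 0"
    "Poly_Mapping.keys p \<subseteq> Poly_Mapping.keys f1" "Poly_Mapping.keys q \<subseteq> Poly_Mapping.keys f2"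
    "\<And>g m n. g \<in> carrier G \<Longrightarrow> m \<in> Poly_Mapping.keys p \<union> Poly_Mapping.keys q \<Longrightarrow>
       n \<in> Poly_Mapping.keys q \<Longrightarrow> weight g (int_exp m) = weight g (int_exp n)"
proof -
  define P where "P k \<longleftrightarrow> (\<exists>p q. f = Fraction_Field.Fract p q \<and> q \<noteq> 0 \<and>
    Poly_Mapping.keys p \<subseteq> Poly_Mapping.keys f1 \<and> Poly_Mapping.keys q \<subseteq> Poly_Mapping.keys f2 \<and>
    card (Poly_Mapping.keys q) = k)" for k
  have "\<exists>k. P k" unfolding P_def using f12 by blast
  then have "P (LEAST k. P k)" by (rule LeastI_ex)
  then obtain p q where pq: "f = Fraction_Field.Fract p q" "q \<noteq> 0"
    "Poly_Mapping.keys p \<subseteq> Poly_Mapping.keys f1" "Poly_Mapping.keys q \<subseteq> Poly_Mapping.keys f2"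
    and least: "card (Poly_Mapping.keys q) = (LEAST k. P k)" unfolding P_def by blast
  have poly: "p \<in> polys N" "q \<in> polys N" using pq f12 polys_subset by blast+
  have "weight g (int_exp m) = weight g (int_exp n)"
    if g: "g \<in> carrier G" and m: "m \<in> Poly_Mapping.keys p \<union> Poly_Mapping.keys q"
      and n: "n \<in> Poly_Mapping.keys q" for g m n
  proof -
    define c where "c = weight g (int_exp n)"
    define p' where "p' = pconst c * p - act g p"
    define q' where "q' = pconst c * q - act g q"
    have lk: "Poly_Mapping.lookup p' k = (c - weight g (int_exp k)) * Poly_Mapping.lookup p k"
      "Poly_Mapping.lookup q' k = (c - weight g (int_exp k)) * Poly_Mapping.lookup q k" for k
      by (simp_all add: p'_def q'_def lookup_minus lookup_act[OF g] poly left_diff_distrib)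
    have keys: "Poly_Mapping.keys p' \<subseteq> Poly_Mapping.keys p" "Poly_Mapping.keys q' \<subseteq> Poly_Mapping.keys q"
      by (auto simp: in_keys_iff lk)
    have "n \<notin> Poly_Mapping.keys q'" by (simp add: in_keys_iff lk c_def)
    then have "Poly_Mapping.keys q' \<subset> Poly_Mapping.keys q" using keys(2) n by blast
    then have less: "card (Poly_Mapping.keys q') < card (Poly_Mapping.keys q)"
      by (simp add: psubset_card_mono)
    have "rat_act G \<rho> N x g f = f" using f g by (simp add: inv_field_def)
    then have "Fraction_Field.Fract (act g p) (act g q) = Fraction_Field.Fract p q"
      using rat_act_Fract[OF g poly pq(2)] pq(1) by simp
    then have "act g p * q = p * act g q"
      using pq(2) act_eq_0_iff[OF g poly(2)] by (simp add: eq_fract)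
    then have cross: "p * q' = p' * q" by (simp add: p'_def q'_def algebra_simps)
    have q'0: "q' = 0"
    proof (rule ccontr)
      assume "q' \<noteq> 0"
      then have "f = Fraction_Field.Fract p' q'" using cross pq by (simp add: eq_fract)
      then have "P (card (Poly_Mapping.keys q'))"
        unfolding P_def using \<open>q' \<noteq> 0\<close> keys pq by blast
      then show False using less least not_less_Least[of _ P] by metis
    qed
    then have p'0: "p' = 0" using cross pq(2) by simp
    show ?thesis
      using m lk[of m] unfolding p'0 q'0 c_def[symmetric] by (auto simp: in_keys_iff)
  qed
  then show thesis using that pq by blast
qed

text \<open>Dividing the numerator of a semi-invariant representation by a monomial of the denominator and
  vice versa leaves only invariant Laurent monomials; their norms are bounded by the degree of the
  given representation, because its monomials are the only ones that occur.\<close>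

lemma invariant_in_field:
  assumes F: "subfield F type_ring" and const: "\<And>c. rconst c \<in> F"
    and f: "f \<in> inv_field G \<rho> N x" and f12: "f = Fraction_Field.Fract f1 f2"
    "f1 \<in> polys N" "f2 \<in> polys N" "f2 \<noteq> 0"
    and mon: "\<And>a. a \<in> inv_lattice G \<rho> N x \<Longrightarrow>
      (\<Sum>i<N. \<bar>Poly_Mapping.lookup a i\<bar>) \<le> int (total_deg f1 + total_deg f2) \<Longrightarrow> laurent_monomial N a \<in> F"
  shows "f \<in> F"
proof (cases "f = 0")
  case True
  then show ?thesis using type_subfield_simps(2)[OF F] by simp
next
  case False
  obtain p q where pq: "f = Fraction_Field.Fract p q" "q \<noteq> 0"
    "Poly_Mapping.keys p \<subseteq> Poly_Mapping.keys f1" "Poly_Mapping.keys q \<subseteq> Poly_Mapping.keys f2"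
    and wt: "\<And>g m n. g \<in> carrier G \<Longrightarrow> m \<in> Poly_Mapping.keys p \<union> Poly_Mapping.keys q \<Longrightarrow>
       n \<in> Poly_Mapping.keys q \<Longrightarrow> weight g (int_exp m) = weight g (int_exp n)"
    using semi_invariant_representation[OF f f12] by blast
  have poly: "p \<in> polys N" "q \<in> polys N" using pq f12 polys_subset by blast+
  have "p \<noteq> 0" using False pq(1) by (auto simp: fract_collapse)
  then obtain m0 where m0: "m0 \<in> Poly_Mapping.keys p" by (metis keys_eq_empty ex_in_conv)
  obtain n0 where n0: "n0 \<in> Poly_Mapping.keys q" using pq(2) by (metis keys_eq_empty ex_in_conv)
  have ratio: "laurent_monomial N (int_exp m - int_exp n) \<in> F"
    if mn: "m \<in> Poly_Mapping.keys p \<and> n \<in> Poly_Mapping.keys q \<or>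
            m \<in> Poly_Mapping.keys q \<and> n \<in> Poly_Mapping.keys p" for m n
  proof (rule mon)
    have k: "Poly_Mapping.keys m \<subseteq> {..<N}" "Poly_Mapping.keys n \<subseteq> {..<N}"
      using mn polys_keys[OF poly(1)] polys_keys[OF poly(2)] by blast+
    have "weight g (int_exp m) = weight g (int_exp n)" if "g \<in> carrier G" for g
      using wt[OF that, of m n] wt[OF that, of n m] mn by auto
    moreover have "Poly_Mapping.keys (int_exp m - int_exp n) \<subseteq> {..<N}"
      using k keys_diff[of "int_exp m" "int_exp n"] by auto
    ultimately show "int_exp m - int_exp n \<in> inv_lattice G \<rho> N x"
      by (auto simp: inv_lattice_iff weight_diff)
    have "monom_deg m + monom_deg n \<le> total_deg f1 + total_deg f2"
      using mn pq(3,4) monom_deg_le_total_deg[of m f1] monom_deg_le_total_deg[of n f2]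
        monom_deg_le_total_deg[of m f2] monom_deg_le_total_deg[of n f1] by force
    moreover have "(\<Sum>i<N. \<bar>Poly_Mapping.lookup (int_exp m - int_exp n) i\<bar>)
        \<le> (\<Sum>i<N. int (Poly_Mapping.lookup m i) + int (Poly_Mapping.lookup n i))"
      by (rule sum_mono) (simp add: lookup_minus)
    moreover have "\<dots> = int (monom_deg m + monom_deg n)"
      using k by (simp add: monom_deg_eq_sum[of "{..<N}"] sum.distrib)
    ultimately show "(\<Sum>i<N. \<bar>Poly_Mapping.lookup (int_exp m - int_exp n) i\<bar>)
        \<le> int (total_deg f1 + total_deg f2)" by linarith
  qed
  have quotient: "to_fract r / laurent_monomial N (int_exp n) \<in> F"
    if r: "r \<in> polys N" and "\<And>m. m \<in> Poly_Mapping.keys r \<Longrightarrow> laurent_monomial N (int_exp m - int_exp n) \<in> F"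
    for r n
  proof -
    have "to_fract r / laurent_monomial N (int_exp n)
      = (\<Sum>m\<in>Poly_Mapping.keys r. rconst (Poly_Mapping.lookup r m) * laurent_monomial N (int_exp m - int_exp n))"
      by (simp add: to_fract_poly[OF r] sum_divide_distrib laurent_monomial_diff)
    also have "\<dots> \<in> F"
      using that const by (intro type_subfield_sum[OF F] type_subfield_simps(4)[OF F]) auto
    finally show ?thesis .
  qed
  have "to_fract p / laurent_monomial N (int_exp n0) \<in> F"
    using ratio n0 by (intro quotient poly) blast
  moreover have "to_fract q / laurent_monomial N (int_exp m0) \<in> F"
    using ratio m0 by (intro quotient poly) blast
  moreover have "laurent_monomial N (int_exp n0 - int_exp m0) \<in> F" using ratio m0 n0 by blast
  ultimately have "(to_fract p / laurent_monomial N (int_exp n0)) / (to_fract q / laurent_monomial N (int_exp m0))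
      * laurent_monomial N (int_exp n0 - int_exp m0) \<in> F"
    by (rule type_subfield_simps(4)[OF F type_subfield_divide[OF F]])
  then show ?thesis by (simp add: pq(1) Fract_conv_to_fract laurent_monomial_diff)
qed

end

section \<open>Degrees of Laurent monomials\<close>

lemma polys_sum: "(\<And>i. i \<in> I \<Longrightarrow> f i \<in> polys N) \<Longrightarrow> sum f I \<in> polys N"
  by (induction I rule: infinite_finite_induct) (auto intro: polys_add)

text \<open>In a representation \<open>f1 / f2\<close> of \<open>x\<^sup>a = x\<^sup>u / x\<^sup>v\<close>, where \<open>u\<close> and \<open>v\<close> have disjoint supports, all
  monomials of \<open>f1\<close> are divisible by \<open>x\<^sup>u\<close>; so \<open>f1 = h x\<^sup>u\<close> and \<open>f2 = h x\<^sup>v\<close>, and \<open>h\<close> is a unit if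
  the representation is reduced.\<close>

lemma rat_deg_laurent_monomial:
  assumes a: "Poly_Mapping.keys a \<subseteq> {..<N}"
  shows "int (rat_deg N (laurent_monomial N a :: 'k::field ratfun)) \<le> (\<Sum>i<N. \<bar>Poly_Mapping.lookup a i\<bar>)"
proof -
  define u where "u = nat_exp a"
  define v where "v = nat_exp (- a)"
  have k: "Poly_Mapping.keys u \<subseteq> {..<N}" "Poly_Mapping.keys v \<subseteq> {..<N}"
    using a keys_nat_exp[of a] keys_nat_exp[of "- a"] by (auto simp: u_def v_def)
  let ?u = "Poly_Mapping.single u 1 :: 'k mpoly" and ?v = "Poly_Mapping.single v 1 :: 'k mpoly"
  obtain f1 f2 :: "'k mpoly" where red: "is_reduced_fraction N (laurent_monomial N a) f1 f2"
    and deg: "rat_deg N (laurent_monomial N a :: 'k ratfun) = total_deg f1 + total_deg f2"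
    using rat_deg_witness[OF laurent_monomial_in_ratfuns[OF a]] .
  have f: "f1 \<in> polys N" "f2 \<in> polys N" "f2 \<noteq> 0" and gcd: "1 gcdof\<^bsub>kV_ring N\<^esub> f1 f2"
    and f12: "laurent_monomial N a = Fraction_Field.Fract f1 f2"
    using red by (auto simp: is_reduced_fraction_def)
  have "laurent_monomial N a = Fraction_Field.Fract ?u ?v"
    unfolding u_def v_def by (rule laurent_monomial_as_Fract[OF a])
  then have "Fraction_Field.Fract f1 f2 = Fraction_Field.Fract ?u ?v" using f12 by simp
  then have cross: "f1 * ?v = f2 * ?u" using f(3) by (simp add: eq_fract mult.commute)
  have shift: "(m - u) + u = m" if m: "m \<in> Poly_Mapping.keys f1" for m
  proof -
    have "Poly_Mapping.lookup (f2 * ?u) (m + v) \<noteq> 0"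
      unfolding cross[symmetric] lookup_mult_single using m by (simp add: in_keys_iff)
    then have "m + v \<in> Poly_Mapping.keys (f2 * ?u)" by (simp add: in_keys_iff)
    then obtain b where "m + v = b + u" using subsetD[OF keys_mult] by fastforce
    then have "Poly_Mapping.lookup (m + v) i = Poly_Mapping.lookup (b + u) i" for i by simp
    then have "Poly_Mapping.lookup m i + nat (- Poly_Mapping.lookup a i)
        = Poly_Mapping.lookup b i + nat (Poly_Mapping.lookup a i)" for i
      by (simp add: lookup_add u_def v_def)
    (* an index in the support of u is not in the support of v, so there m has to absorb u *)
    then have "Poly_Mapping.lookup u i \<le> Poly_Mapping.lookup m i" for i
      by (cases "0 \<le> Poly_Mapping.lookup a i") (simp_all add: u_def, metis add.right_neutral le_add2 nat_0_iff neg_le_0_iff_le)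
    then show ?thesis by (intro poly_mapping_eqI) (simp add: lookup_add lookup_minus)
  qed
  define h where "h = (\<Sum>m\<in>Poly_Mapping.keys f1. Poly_Mapping.single (m - u) (Poly_Mapping.lookup f1 m))"
  have "Poly_Mapping.keys (m - u) \<subseteq> Poly_Mapping.keys m" for m
    by (auto simp: in_keys_iff lookup_minus)
  then have h: "h \<in> polys N"
    unfolding h_def using polys_keys[OF f(1)] by (intro polys_sum polys_single) blast
  have "h * ?u = (\<Sum>m\<in>Poly_Mapping.keys f1. Poly_Mapping.single m (Poly_Mapping.lookup f1 m))"
    unfolding h_def sum_distrib_right by (rule sum.cong) (simp_all add: mult_single shift)
  also have "\<dots> = f1" by (rule poly_eq_sum_single[symmetric]) auto
  finally have f1: "f1 = h * ?u" ..
  then have "(h * ?v) * ?u = f2 * ?u" using cross by (simp add: mult_ac)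
  then have f2: "f2 = h * ?v" by simp
  have "h divides\<^bsub>kV_ring N\<^esub> 1"
    using gcd h polys_single[OF k(1), of 1] polys_single[OF k(2), of 1] f1 f2
    by (auto simp: isgcd_def factor_def)
  then obtain r where r: "1 = h * r" by (auto simp: factor_def)
  then have "h \<noteq> 0" "r \<noteq> 0" by auto
  then have "total_deg h \<le> total_deg (1 :: 'k mpoly)" using total_deg_mult_ge[of h r] r by simp
  also have "\<dots> = 0" by (simp add: total_deg_def)
  finally obtain c where "h = pconst c" using total_deg_0_imp_pconst[of h] by auto
  then have "f1 = Poly_Mapping.single u c" "f2 = Poly_Mapping.single v c"
    using f1 f2 by (simp_all add: pconst_def mult_single)
  then have "int (rat_deg N (laurent_monomial N a :: 'k ratfun)) \<le> int (monom_deg u + monom_deg v)"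
    unfolding deg using total_deg_single[of u c] total_deg_single[of v c] by simp
  also have "int (monom_deg u + monom_deg v)
      = (\<Sum>i<N. int (Poly_Mapping.lookup u i) + int (Poly_Mapping.lookup v i))"
    unfolding monom_deg_eq_sum[OF finite_lessThan k(1)] monom_deg_eq_sum[OF finite_lessThan k(2)]
    by (simp add: sum.distrib)
  also have "\<dots> = (\<Sum>i<N. \<bar>Poly_Mapping.lookup a i\<bar>)"
    by (rule sum.cong) (auto simp: u_def v_def)
  finally show ?thesis .
qed

section \<open>Lattice points in the cross-polytope\<close>

lemma lattice_points_in_dilate:
  assumes "d > 0" "\<And>a. a \<in> L \<Longrightarrow> Poly_Mapping.keys a \<subseteq> {..<N}"
  shows "lattice_points_in L (dilate d (cross_polytope N))
       = {a \<in> L. (\<Sum>i<N. \<bar>Poly_Mapping.lookup a i\<bar>) \<le> int d}"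
proof -
  have "(\<lambda>i. real_of_int (Poly_Mapping.lookup a i)) \<in> dilate d (cross_polytope N)
      \<longleftrightarrow> (\<Sum>i<N. \<bar>Poly_Mapping.lookup a i\<bar>) \<le> int d" if a: "a \<in> L" for a
  proof -
    let ?a = "\<lambda>i. real_of_int (Poly_Mapping.lookup a i)"
    have 0: "?a i = 0" if "i \<ge> N" for i
    proof -
      have "i \<notin> Poly_Mapping.keys a" using assms(2)[OF a] that by auto
      then show ?thesis by (simp add: in_keys_iff)
    qed
    have "?a \<in> dilate d (cross_polytope N) \<longleftrightarrow> (\<lambda>i. ?a i / real d) \<in> cross_polytope N"
    proof
      assume "?a \<in> dilate d (cross_polytope N)"
      then obtain v where v: "v \<in> cross_polytope N" "?a = (\<lambda>i. real d * v i)"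
        unfolding dilate_def by blast
      have "?a i / real d = v i" for i using fun_cong[OF v(2), of i] assms(1) by simp
      then show "(\<lambda>i. ?a i / real d) \<in> cross_polytope N" using v(1) by simp
    next
      assume "(\<lambda>i. ?a i / real d) \<in> cross_polytope N"
      then show "?a \<in> dilate d (cross_polytope N)"
        unfolding dilate_def by (rule image_eqI[rotated]) (use assms(1) in simp)
    qed
    also have "\<dots> \<longleftrightarrow> (\<Sum>i<N. \<bar>?a i\<bar>) / real d \<le> 1"
      using 0 by (simp add: cross_polytope_def abs_divide sum_divide_distrib)
    also have "\<dots> \<longleftrightarrow> (\<Sum>i<N. \<bar>?a i\<bar>) \<le> real d" using assms(1) by simp
    also have "\<dots> \<longleftrightarrow> real_of_int (\<Sum>i<N. \<bar>Poly_Mapping.lookup a i\<bar>) \<le> real_of_int (int d)" by simp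
    finally show ?thesis by (simp only: of_int_le_iff)
  qed
  then show ?thesis unfolding lattice_points_in_def by blast
qed

lemma sublattice_generate:
  assumes "\<And>a. a \<in> S \<Longrightarrow> Poly_Mapping.keys a \<subseteq> {..<N}"
  shows "sublattice N (generate (Z_pow N) S)"
proof -
  have "subgroup (generate (Z_pow N) S) (Z_pow N)"
    using assms by (intro group.generate_is_subgroup) auto
  note sub = subgroup.mem_carrier[OF this] subgroup.one_closed[OF this] subgroup.m_closed[OF this]
    subgroup.m_inv_closed[OF this]
  have keys: "Poly_Mapping.keys a \<subseteq> {..<N}" if "a \<in> generate (Z_pow N) S" for a
    using sub(1)[OF that] by simp
  have "- a \<in> generate (Z_pow N) S" if "a \<in> generate (Z_pow N) S" for a
    using sub(4)[OF that] inv_free_Abelian_group[OF keys[OF that]] by simp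
  then show ?thesis
    unfolding sublattice_def using sub(2,3) keys by auto
qed

lemma generate_subset_sublattice:
  assumes L: "sublattice N L" and "S \<subseteq> L"
  shows "generate (Z_pow N) S \<subseteq> L"
proof
  fix a assume "a \<in> generate (Z_pow N) S"
  then show "a \<in> L"
    by (induction rule: generate.induct)
      (use assms(2) sublatticeD[OF L] in \<open>auto simp: inv_free_Abelian_group subset_iff\<close>)
qed

section \<open>Invariant fields as monomial fields\<close>

context diagonal_action
begin

lemma inv_field_eq: "inv_field G \<rho> N x = monomial_field N (inv_lattice G \<rho> N x)"
proof
  note F = monomial_field_is_subfield[of N "inv_lattice G \<rho> N x", where ?'a = 'k]
  show "inv_field G \<rho> N x \<subseteq> monomial_field N (inv_lattice G \<rho> N x)"
  proof
    fix f assume f: "f \<in> inv_field G \<rho> N x"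
    then have "f \<in> ratfuns N" by (simp add: inv_field_def)
    then obtain p q where "p \<in> polys N" "q \<in> polys N" "q \<noteq> 0" "f = Fraction_Field.Fract p q"
      by (rule ratfunsE)
    then show "f \<in> monomial_field N (inv_lattice G \<rho> N x)"
      by (intro invariant_in_field[OF F rconst_in_monomial_field f]) (auto intro: laurent_monomial_in_field)
  qed
  show "monomial_field N (inv_lattice G \<rho> N x) \<subseteq> inv_field G \<rho> N x"
    using laurent_monomial_in_inv_field rconst_in_inv_field
    by (intro monomial_field_least[OF inv_field_is_subfield]) (auto simp: rconsts_eq)
qed

text \<open>Invariants of degree at most \<open>d\<close> are built from invariant monomials of norm at most \<open>d\<close>, and
  those monomials are themselves invariants of degree at most \<open>d\<close>.\<close>

lemma inv_le_field_eq:
  assumes d: "d > 0"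
  defines "S \<equiv> lattice_points_in (inv_lattice G \<rho> N x) (dilate d (cross_polytope N))"
  shows "gen_subfield (inv_le G \<rho> N x d) = monomial_field N (generate (Z_pow N) S)"
proof
  let ?F = "monomial_field N (generate (Z_pow N) S) :: 'k ratfun set"
  let ?K = "gen_subfield (inv_le G \<rho> N x d)"
  have S: "S = {a \<in> inv_lattice G \<rho> N x. (\<Sum>i<N. \<bar>Poly_Mapping.lookup a i\<bar>) \<le> int d}"
    unfolding S_def using sublatticeD(1)[OF sublattice_inv_lattice] by (intro lattice_points_in_dilate[OF d])
  note F = monomial_field_is_subfield[of N "generate (Z_pow N) S", where ?'a = 'k]
  have "f \<in> ?F" if f: "f \<in> inv_le G \<rho> N x d" for f
  proof -
    have inv: "f \<in> inv_field G \<rho> N x" and deg: "rat_deg N f \<le> d" using f by (auto simp: inv_le_def)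
    then have "f \<in> ratfuns N" by (simp add: inv_field_def)
    then obtain p q where "is_reduced_fraction N f p q" "rat_deg N f = total_deg p + total_deg q"
      by (rule rat_deg_witness)
    then show ?thesis
      using deg
      by (intro invariant_in_field[OF F rconst_in_monomial_field inv, of p q] laurent_monomial_in_field generate.incl)
        (auto simp: is_reduced_fraction_def S)
  qed
  then show "?K \<subseteq> ?F"
    by (intro gen_subfield_least[OF F]) (auto simp: rconsts_eq rconst_in_monomial_field)
  note K = gen_subfield_is_subfield[of "inv_le G \<rho> N x d"]
  have mono: "laurent_monomial N a \<in> ?K" if a: "a \<in> S" for a
  proof -
    have "int (rat_deg N (laurent_monomial N a :: 'k ratfun)) \<le> int d"
      using a rat_deg_laurent_monomial[of a N, where ?'k = 'k] sublatticeD(1)[OF sublattice_inv_lattice, of a]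
      unfolding S by (auto intro: order_trans)
    then have "laurent_monomial N a \<in> inv_le G \<rho> N x d"
      using a laurent_monomial_in_inv_field by (auto simp: inv_le_def S)
    then show ?thesis using subset_gen_subfield by blast
  qed
  have keys: "Poly_Mapping.keys a \<subseteq> {..<N}" if "a \<in> S" for a
    using that sublatticeD(1)[OF sublattice_inv_lattice] by (auto simp: S)
  have "laurent_monomial N a \<in> ?K" if "a \<in> generate (Z_pow N) S" for a
    using that
  proof (induction rule: generate.induct)
    case (inv a)
    then show ?case
      using type_subfield_inverse[OF K mono] inv_free_Abelian_group[OF keys]
      by (simp add: laurent_monomial_uminus)
  next
    case (eng a b)
    then show ?case using type_subfield_simps(4)[OF K] by (simp add: laurent_monomial_add)
  qed (use type_subfield_simps(1)[OF K] mono in simp_all)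
  then show "?F \<subseteq> ?K"
    by (intro monomial_field_least[OF K]) (auto simp: rconsts_eq rconst_in_gen_subfield)
qed

end

section \<open>From representations to characters\<close>

text \<open>The eigenvalues on each basis form are multiplicative in the group element, because the dual
  action reverses the order twice; their \<open>|G|\<close>-th powers are therefore trivial.\<close>

lemma diagonal_action_exists:
  fixes G :: "('g, 'm) monoid_scheme" and scale :: "'k::field \<Rightarrow> 'v::ab_group_add \<Rightarrow> 'v"
  assumes "group G" and fin: "finite (carrier G)" and rep: "is_linear_rep G scale \<rho>"
    and basis: "is_dual_basis scale N x" and diag: "acts_diagonally G \<rho> N x"
  shows "\<exists>\<chi>. diagonal_action G \<rho> N x \<chi> (Coset.order G)"
proof -
  interpret group G by fact
  have inj: "inj_on x {..<N}" and ind: "\<not> fun_space.dependent (x ` {..<N})"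
    using basis by (auto simp: is_dual_basis_def)
  obtain \<chi> where \<chi>: "\<And>g i. g \<in> carrier G \<Longrightarrow> i < N \<Longrightarrow> dual_act G \<rho> g (x i) = fun_scale (\<chi> g i) (x i)"
    using diag unfolding acts_diagonally_def by metis
  have lin: "lin_form_act G \<rho> N x g i = pconst (\<chi> g i) * pvar i" if g: "g \<in> carrier G" and i: "i < N" for g i
  proof -
    let ?B = "x ` {..<N}"
    have xi: "x i \<in> ?B" using i by blast
    have "fun_space.representation ?B (dual_act G \<rho> g (x i)) (x j) = (if j = i then \<chi> g i else 0)" if j: "j < N" for j
      unfolding \<chi>[OF g i] fun_space.representation_scale[OF ind fun_space.span_base[OF xi]]
        fun_space.representation_basis[OF ind xi]
      using inj i j by (auto dest: inj_onD)
    then have "lin_form_act G \<rho> N x g i = (\<Sum>j<N. if j = i then pconst (\<chi> g i) * pvar i else 0)"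
      unfolding lin_form_act_def by (intro sum.cong) auto
    then show ?thesis using i by simp
  qed
  have nz: "\<exists>v. x i v \<noteq> 0" if i: "i < N" for i
  proof (rule ccontr)
    assume "\<nexists>v. x i v \<noteq> 0"
    then have "x i = 0" by (simp add: fun_eq_iff)
    then have "0 \<in> x ` {..<N}" using i by (metis imageI lessThan_iff)
    then have "fun_space.dependent (x ` {..<N})" by (rule fun_space.dependent_zero)
    then show False using ind by contradiction
  qed
  have cancel: "c = c'" if "fun_scale c (x i) = fun_scale c' (x i)" "i < N" for c c' i
    using nz[OF that(2)] fun_cong[OF that(1)] by (auto simp: fun_scale_def)
  have one: "\<chi> \<one>\<^bsub>G\<^esub> i = 1" if i: "i < N" for i
  proof -
    have "dual_act G \<rho> \<one>\<^bsub>G\<^esub> (x i) = fun_scale 1 (x i)"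
      using rep by (simp add: dual_act_def is_linear_rep_def fun_scale_def)
    then show ?thesis using \<chi>[of "\<one>\<^bsub>G\<^esub>" i] i by (intro cancel[of _ i]) auto
  qed
  have mult: "\<chi> (g \<otimes>\<^bsub>G\<^esub> h) i = \<chi> g i * \<chi> h i" if g: "g \<in> carrier G" and h: "h \<in> carrier G" and i: "i < N" for g h i
  proof -
    have "dual_act G \<rho> (g \<otimes>\<^bsub>G\<^esub> h) (x i) = dual_act G \<rho> g (dual_act G \<rho> h (x i))"
      using rep g h by (simp add: dual_act_def is_linear_rep_def inv_mult_group comp_assoc)
    also have "\<dots> = fun_scale (\<chi> h i) (dual_act G \<rho> g (x i))"
      unfolding \<chi>[OF h i] by (auto simp: dual_act_def fun_scale_def)
    also have "\<dots> = fun_scale (\<chi> g i * \<chi> h i) (x i)"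
      unfolding \<chi>[OF g i] by (auto simp: fun_scale_def)
    finally show ?thesis using \<chi>[of "g \<otimes>\<^bsub>G\<^esub> h" i] g h i by (intro cancel[of _ i]) auto
  qed
  have power: "\<chi> (g [^]\<^bsub>G\<^esub> n) i = \<chi> g i ^ n" if "g \<in> carrier G" "i < N" for g i and n :: nat
    using that by (induction n) (auto simp: one mult mult.commute)
  have "\<chi> g i ^ Coset.order G = 1" if "g \<in> carrier G" "i < N" for g i
    using power[OF that, of "Coset.order G"] pow_order_eq_1[OF that(1)] one[OF that(2)] by simp
  moreover have "Coset.order G > 0" using fin by (simp add: order_gt_0_iff_finite)
  ultimately have "diagonal_action G \<rho> N x \<chi> (Coset.order G)"
    using lin by unfold_locales
  then show ?thesis by blast
qed

theorem lemma3p6: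
  fixes G :: "('g, 'm) monoid_scheme"
    and scale :: "'k::field \<Rightarrow> 'v::ab_group_add \<Rightarrow> 'v"
    and \<rho> :: "'g \<Rightarrow> 'v \<Rightarrow> 'v"
    and x :: "nat \<Rightarrow> 'v \<Rightarrow> 'k"
    and N d :: nat
  defines "L \<equiv> inv_lattice G \<rho> N x"
    and "M \<equiv> generate (Z_pow N)
                (lattice_points_in (inv_lattice G \<rho> N x) (dilate d (cross_polytope N)))"
    and "E \<equiv> inv_field G \<rho> N x"
    and "K \<equiv> gen_subfield (inv_le G \<rho> N x d)"
  assumes "comm_group G" and "finite (carrier G)"
    and "\<not> CHAR('k) dvd Coset.order G"
    and "{z :: 'k alg_closure. z ^ Coset.order G = 1} \<subseteq> range to_ac"
    and "\<exists>B. finite_dimensional_vector_space scale B"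
    and "is_linear_rep G scale \<rho>"
    and "N = vector_space.dim scale UNIV"
    and "is_dual_basis scale N x"
    and "acts_diagonally G \<rho> N x"
    and "d > 0"
  shows "(M = L \<longleftrightarrow> K = E) \<and>
         (lattice_rank M = lattice_rank L \<longleftrightarrow>
            ring.finite_dimension ring_of_type_algebra K E) \<and>
         (lattice_rank M = lattice_rank L \<longrightarrow>
            ring.dim ring_of_type_algebra K E = subgroup_index N L M)"
proof -
  have "group G" using assms(5) by (rule comm_group.axioms(2))
  then obtain \<chi> where "diagonal_action G \<rho> N x \<chi> (Coset.order G)"
    using diagonal_action_exists assms(6,10,12,13) by blast
  then interpret diagonal_action G \<rho> N x \<chi> "Coset.order G" .
  have L: "sublattice N L" unfolding L_def by (rule sublattice_inv_lattice)
  have M: "sublattice N M"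
    unfolding M_def using sublatticeD(1)[OF sublattice_inv_lattice]
    by (intro sublattice_generate) (auto simp: lattice_points_in_def)
  have sub: "M \<subseteq> L"
    unfolding M_def L_def
    by (rule generate_subset_sublattice[OF sublattice_inv_lattice]) (auto simp: lattice_points_in_def)
  have K: "K = monomial_field N M" unfolding K_def M_def by (rule inv_le_field_eq) fact
  have E: "E = monomial_field N L" unfolding E_def L_def by (rule inv_field_eq)
  have rank: "lattice_rank M = lattice_rank L \<longleftrightarrow> finite (coset M ` L)"
    unfolding lattice_rank_eq_iff[OF M L sub]
  proof
    assume "\<forall>a\<in>L. \<exists>n>0. frag_cmul n a \<in> M"
    then show "finite (coset M ` L)"
      using e_pos single_in_inv_lattice
      by (intro torsion_imp_finite_cosets[OF M L, of "int (Coset.order G)"]) (auto simp: L_def)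
  qed (use finite_cosets_imp_torsion[OF M L] in blast)
  have index: "subgroup_index N L M = card (coset M ` L)"
    by (simp add: subgroup_index_def rcosets_eq)
  have "M = L \<longleftrightarrow> K = E" unfolding K E using monomial_field_eq_iff[OF M L sub] by blast
  moreover have "R.finite_dimension K E" "R.dim K E = subgroup_index N L M" if "finite (coset M ` L)"
    using monomial_fields_dimension[OF M L sub that, where ?'k = 'k] unfolding K E index
    using R.dimI[OF monomial_field_is_subfield] by (auto simp: R.finite_dimension_def over_def)
  moreover have "\<not> R.finite_dimension K E" if "infinite (coset M ` L)"
    unfolding K E by (rule monomial_fields_infinite_dimension[OF M L that])
  ultimately show ?thesis unfolding rank by blast
qed

end
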